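(* Let $f:(M,g)\to(N,h)$ be a holomorphic map between Hermitian manifolds with $\dim_{\mathbb C}M=m\le n=\dim_{\mathbb C}N$, let $1\le \ell\le m$, and let $p\in M$. Let $(z^1,\dots,z^m)$ be local holomorphic coordinates of $M$ near $p$ and $(\omega^1,\dots,\omega^n)$ local holomorphic coordinates of $N$ near $f(p)$ such that $g_{\alpha\overline\beta}=\delta_{\alpha\beta}$ at $p$, $h_{i\overline j}=\delta_{ij}$ at $f(p)$, and at $p$ $$\partial f\Big(\frac{\partial}{\partial z^\alpha}\Big)=\sum_{i=1}^n\lambda_\alpha\delta_{i\alpha}\frac{\partial}{\partial\omega^i}\qquad(1\le\alpha\le m),$$ with $|\lambda_1|\ge\cdots\ge|\lambda_m|$ (so that $|\lambda_1|,\dots,|\lambda_m|$ are the singular values of $\partial f:(T'_pM,g)\to(T'_{f(p)}N,h)$). Let $U_\ell=\sum_{1\le\alpha,\beta\le\ell}g^{\alpha\overline\beta}A_{\alpha\overline\beta}$, a function defined in a small neighborhood of $p$. If $U_\ell(p)\ne0$, then at $p$ $$\partial\overline{\partial}\, U_{\ell}=\sum_{\alpha,\beta=1}^m\Big(\sum_{\delta=1}^{\ell}R^{M}(\alpha,\overline{\beta},\delta,\overline{\delta})|\lambda_{\delta}|^{2}-\sum_{\gamma=1}^{\ell}R^{N}(\alpha,\overline{\beta},\gamma,\overline{\gamma})|\lambda_{\gamma}|^{2}\lambda_{\alpha}\overline{\lambda_{\beta}}\Big)dz^{\alpha}\wedge d\overline{z}^{\beta}+\langle\nabla V_{\ell},\nabla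 V_{\ell}\rangle,$$ where $\nabla$ is the induced connection on the bundle $E=T'^{*}M\otimes f^{*}(T'N)$ and $V_\ell=\sum_{\alpha=1}^\ell\sum_{i=1}^n f^i_\alpha\,dz^\alpha\otimes e_i$, with $e_i=f^*\frac{\partial}{\partial\omega^i}$, is the corresponding section of $E$ over the coordinate neighborhood of $p$.
   Context: Notation. In the local coordinates, $f^i=\omega^i\circ f$, $f^i_\alpha=\partial f^i/\partial z^\alpha$; $\partial f:T'M\to T'N$ is the tangent map on holomorphic tangent bundles, $\partial f(\partial/\partial z^\alpha)=\sum_{i}f^i_\alpha\,\partial/\partial\omega^i$. The pull-back $f^*h$ has components $A_{\alpha\overline\beta}=\sum_{i,j=1}^n f^i_\alpha\overline{f^j_\beta}h_{i\overline j}$. $(g^{\alpha\overline\beta})$ is the inverse of the full $m\times m$ matrix $(g_{\alpha\overline\beta})$. The Chern curvature tensor of a Hermitian metric $g$ is $$R_{i\overline{j}k\overline{l}}=-\frac{\partial^{2}g_{k\overline{l}}}{\partial z^{i}\partial \overline{z}^{j}}+\sum_{p,q}g^{p\overline{q}}\frac{\partial g_{k\overline{q}}}{\partial z^{i}}\frac{\partial g_{p\overline{l}}}{\partial \overline{z}^{j}}.$$ $R^M(\alpha,\overline\beta,\delta,\overline\delta)=R^M_{\alpha\overline\beta\delta\overline\delta}$ is the component of the Chern curvature of $g$ with respect to $\partial/\partial z^\alpha$, etc., at $p$; $R^N(\alpha,\overline\beta,\gamma,\overline\gamma)=R^N_{\alpha\overline\beta\gamma\overline\gamma}$ is the component of the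 Chern curvature of $h$ with respect to $\partial/\partial\omega^\alpha$, etc., at $f(p)$. The holomorphic bundle $E=T'^*M\otimes f^*(T'N)$ carries the Hermitian metric induced by $g$ and $h$, and $\nabla$ is its Chern connection (induced by the Chern connections of $g$ and $h$). For the holomorphic local section $V_\ell$, $\langle\nabla V_\ell,\nabla V_\ell\rangle$ denotes the $(1,1)$-form $\sum_{\alpha,\beta}\langle\nabla_{\alpha}V_\ell,\nabla_\beta V_\ell\rangle_E\,dz^\alpha\wedge d\overline z^\beta$, where $\nabla_\alpha=\nabla_{\partial/\partial z^\alpha}$ and $\langle\cdot,\cdot\rangle_E$ is the Hermitian metric of $E$ (conjugate-linear in the second slot). *)

theory Defs
  imports "HOL-Analysis.Analysis"
begin

section \<open>Calculus on \<open>\<complex>\<^sup>m\<close>\<close>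

text \<open>For a function on an open set, real differentiability with complex-linear derivative.\<close>

definition holomorphic_vec_on ::
    "(complex^'m::finite \<Rightarrow> complex^'n::finite) \<Rightarrow> (complex^'m) set \<Rightarrow> bool"  (infix \<open>holomorphic'_vec'_on\<close> 50)
  where "F holomorphic_vec_on S \<longleftrightarrow>
    (\<forall>x\<in>S. \<exists>L. (F has_derivative L) (at x) \<and> (\<forall>c v. L (c *s v) = c *s L v))"

text \<open>Real differentiability classes on an open set: a \<open>C\<^sup>k\<^sup>+\<^sup>1\<close> function is differentiable and all
  its directional derivatives are \<open>C\<^sup>k\<close>.\<close>

primrec Ck_on :: "nat \<Rightarrow> ('a::real_normed_vector \<Rightarrow> 'b::real_normed_vector) \<Rightarrow> 'a set \<Rightarrow> bool"
  where
    "Ck_on 0 F S \<longleftrightarrow> continuous_on S F"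
  | "Ck_on (Suc k) F S \<longleftrightarrow>
      (\<forall>x\<in>S. F differentiable (at x)) \<and> (\<forall>v. Ck_on k (\<lambda>x. frechet_derivative F (at x) v) S)"

definition smooth_fun_on :: "('a::real_normed_vector \<Rightarrow> 'b::real_normed_vector) \<Rightarrow> 'a set \<Rightarrow> bool"
  where "smooth_fun_on F S \<longleftrightarrow> (\<forall>k. Ck_on k F S)"

text \<open>Wirtinger operators; \<open>zb\<close> stands for the conjugate coordinate: \<open>\<partial>/\<partial>z\<^sup>a = (\<partial>/\<partial>x\<^sup>a - \<i> \<partial>/\<partial>y\<^sup>a)/2\<close> and
  \<open>\<partial>/\<partial>zb\<^sup>a = (\<partial>/\<partial>x\<^sup>a + \<i> \<partial>/\<partial>y\<^sup>a)/2\<close>.\<close>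

definition wirtinger :: "'m::finite \<Rightarrow> (complex^'m \<Rightarrow> complex) \<Rightarrow> complex^'m \<Rightarrow> complex"
  where "wirtinger a F x =
    (frechet_derivative F (at x) (axis a 1) - \<i> * frechet_derivative F (at x) (axis a \<i>)) / 2"

definition wirtinger_bar :: "'m::finite \<Rightarrow> (complex^'m \<Rightarrow> complex) \<Rightarrow> complex^'m \<Rightarrow> complex"
  where "wirtinger_bar a F x =
    (frechet_derivative F (at x) (axis a 1) + \<i> * frechet_derivative F (at x) (axis a \<i>)) / 2"


section \<open>Complex manifolds\<close>

text \<open>A chart is a domain together with a coordinate map; the values of the coordinate map
  outside the domain are irrelevant.\<close>

type_synonym ('a, 'm) chart = "'a set \<times> ('a \<Rightarrow> complex^'m)"

definition chart_inv :: "('a, 'm::finite) chart \<Rightarrow> complex^'m \<Rightarrow> 'a"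
  where "chart_inv c = inv_into (fst c) (snd c)"

definition is_chart :: "'a topology \<Rightarrow> ('a, 'm::finite) chart \<Rightarrow> bool"
  where "is_chart X c \<longleftrightarrow> openin X (fst c) \<and> open (snd c ` fst c) \<and>
    homeomorphic_map (subtopology X (fst c)) (top_of_set (snd c ` fst c)) (snd c)"

definition compatible :: "('a, 'm::finite) chart \<Rightarrow> ('a, 'm) chart \<Rightarrow> bool"
  where "compatible c d \<longleftrightarrow>
    (snd d \<circ> chart_inv c) holomorphic_vec_on (snd c ` (fst c \<inter> fst d)) \<and>
    (snd c \<circ> chart_inv d) holomorphic_vec_on (snd d ` (fst c \<inter> fst d))"

text \<open>\<open>A\<close> is the maximal atlas, so its members are all the local holomorphic coordinate systems.\<close>

definition complex_manifold :: "'a topology \<Rightarrow> ('a, 'm::finite) chart set \<Rightarrow> bool"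
  where "complex_manifold X A \<longleftrightarrow>
    Hausdorff_space X \<and> second_countable X \<and>
    (\<forall>c\<in>A. is_chart X c) \<and>
    (\<forall>q\<in>topspace X. \<exists>c\<in>A. q \<in> fst c) \<and>
    (\<forall>c\<in>A. \<forall>d\<in>A. compatible c d) \<and>
    (\<forall>c. is_chart X c \<and> (\<forall>d\<in>A. compatible c d) \<longrightarrow> c \<in> A)"

definition holomorphic_map ::
    "'a topology \<Rightarrow> ('a, 'm::finite) chart set \<Rightarrow> 'b topology \<Rightarrow> ('b, 'n::finite) chart set \<Rightarrow> ('a \<Rightarrow> 'b) \<Rightarrow> bool"
  where "holomorphic_map X A Y B f \<longleftrightarrow> continuous_map X Y f \<and>
    (\<forall>c\<in>A. \<forall>d\<in>B.
      (snd d \<circ> f \<circ> chart_inv c) holomorphic_vec_on (snd c ` {q \<in> fst c. f q \<in> fst d}))"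

text \<open>\<open>pd c a F q\<close> is \<open>\<partial>F/\<partial>z\<^sup>a\<close> and \<open>pd_bar c a F q\<close> is \<open>\<partial>F/\<partial>zb\<^sup>a\<close> at the point \<open>q\<close>, where \<open>z\<close> are the
  coordinates of the chart \<open>c\<close>; both depend only on the germ of \<open>F\<close> at \<open>q\<close>.\<close>

definition pd :: "('a, 'm::finite) chart \<Rightarrow> 'm \<Rightarrow> ('a \<Rightarrow> complex) \<Rightarrow> 'a \<Rightarrow> complex"
  where "pd c a F q = wirtinger a (F \<circ> chart_inv c) (snd c q)"

definition pd_bar :: "('a, 'm::finite) chart \<Rightarrow> 'm \<Rightarrow> ('a \<Rightarrow> complex) \<Rightarrow> 'a \<Rightarrow> complex"
  where "pd_bar c a F q = wirtinger_bar a (F \<circ> chart_inv c) (snd c q)"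


section \<open>Hermitian metrics\<close>

text \<open>A Hermitian metric is given by its components \<open>g c q $ a $ b = g(\<partial>/\<partial>z\<^sup>a, \<partial>/\<partial>zb\<^sup>b)\<close> at \<open>q\<close> in every
  holomorphic chart \<open>c\<close>, subject to the tensor transformation law.\<close>

type_synonym ('a, 'm) metric = "('a, 'm) chart \<Rightarrow> 'a \<Rightarrow> complex^'m^'m"

definition hermitian_metric :: "('a, 'm::finite) chart set \<Rightarrow> ('a, 'm) metric \<Rightarrow> bool"
  where "hermitian_metric A g \<longleftrightarrow>
    (\<forall>c\<in>A. smooth_fun_on (g c \<circ> chart_inv c) (snd c ` fst c)) \<and>
    (\<forall>c\<in>A. \<forall>q\<in>fst c. \<forall>a b. g c q $ b $ a = cnj (g c q $ a $ b)) \<and>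
    (\<forall>c\<in>A. \<forall>q\<in>fst c. \<forall>v. v \<noteq> 0 \<longrightarrow>
      Re (\<Sum>a\<in>UNIV. \<Sum>b\<in>UNIV. g c q $ a $ b * v $ a * cnj (v $ b)) > 0) \<and>
    (\<forall>c\<in>A. \<forall>d\<in>A. \<forall>q\<in>fst c \<inter> fst d. \<forall>a b.
      g c q $ a $ b = (\<Sum>k\<in>UNIV. \<Sum>l\<in>UNIV. g d q $ k $ l *
        pd c a (\<lambda>r. snd d r $ k) q * cnj (pd c b (\<lambda>r. snd d r $ l) q)))"

text \<open>\<open>metric_inv g c q a b\<close> is \<open>g\<^sup>a\<^sup>b\<close> with first index unbarred and second index barred, normalised
  by \<open>\<Sum>b. g\<^sup>a\<^sup>b g\<^sub>k\<^sub>b = \<delta>\<^sup>a\<^sub>k\<close>; as a matrix this is the transpose of the inverse of \<open>(g\<^sub>a\<^sub>b)\<close>.\<close>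

definition metric_inv :: "('a, 'm::finite) metric \<Rightarrow> ('a, 'm) chart \<Rightarrow> 'a \<Rightarrow> 'm \<Rightarrow> 'm \<Rightarrow> complex"
  where "metric_inv g c q a b = matrix_inv (g c q) $ b $ a"

text \<open>\<open>chern_curvature g c i j k l q\<close> is \<open>R(\<partial>/\<partial>z\<^sup>i, \<partial>/\<partial>zb\<^sup>j, \<partial>/\<partial>z\<^sup>k, \<partial>/\<partial>zb\<^sup>l)\<close> at \<open>q\<close>.\<close>

definition chern_curvature ::
    "('a, 'm::finite) metric \<Rightarrow> ('a, 'm) chart \<Rightarrow> 'm \<Rightarrow> 'm \<Rightarrow> 'm \<Rightarrow> 'm \<Rightarrow> 'a \<Rightarrow> complex"
  where "chern_curvature g c i j k l q =
    - pd c i (pd_bar c j (\<lambda>r. g c r $ k $ l)) q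
    + (\<Sum>s\<in>UNIV. \<Sum>t\<in>UNIV. metric_inv g c q s t *
        pd c i (\<lambda>r. g c r $ k $ t) q * pd_bar c j (\<lambda>r. g c r $ s $ l) q)"

text \<open>Coefficients of the Chern connection of the tangent bundle:
  \<open>\<nabla>\<^sub>a \<partial>/\<partial>z\<^sup>k = \<Sum>j. chern_connection g c a k j q \<cdot> \<partial>/\<partial>z\<^sup>j\<close>, where \<open>\<nabla>\<^sub>a\<close> is taken along \<open>\<partial>/\<partial>z\<^sup>a\<close>. This is the
  connection matrix \<open>\<partial>g \<cdot> g\<^sup>-\<^sup>1\<close>, equivalently \<open>g(\<nabla>\<^sub>a \<partial>/\<partial>z\<^sup>k, \<partial>/\<partial>zb\<^sup>b) = \<partial>g\<^sub>k\<^sub>b/\<partial>z\<^sup>a\<close>, as forced by metric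
  compatibility and the \<open>(0,1)\<close>-part being \<open>\<partial>\<close>-bar.\<close>

definition chern_connection ::
    "('a, 'm::finite) metric \<Rightarrow> ('a, 'm) chart \<Rightarrow> 'm \<Rightarrow> 'm \<Rightarrow> 'm \<Rightarrow> 'a \<Rightarrow> complex"
  where "chern_connection g c a k j q =
    (\<Sum>b\<in>UNIV. pd c a (\<lambda>r. g c r $ k $ b) q * metric_inv g c q j b)"


section \<open>Holomorphic maps in coordinates\<close>

text \<open>In this section \<open>c\<close> is a chart of the source with coordinates \<open>z\<close> and \<open>d\<close> a chart of the
  target with coordinates \<open>w\<close>. \<open>map_pd c d f i a q\<close> is \<open>f\<^sup>i\<^sub>a = \<partial>(w\<^sup>i \<circ> f)/\<partial>z\<^sup>a\<close> at \<open>q\<close>.\<close>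

definition map_pd ::
    "('a, 'm::finite) chart \<Rightarrow> ('b, 'n::finite) chart \<Rightarrow> ('a \<Rightarrow> 'b) \<Rightarrow> 'n \<Rightarrow> 'm \<Rightarrow> 'a \<Rightarrow> complex"
  where "map_pd c d f i a q = pd c a (\<lambda>r. snd d (f r) $ i) q"

text \<open>The coordinate vector of \<open>\<partial>f(\<partial>/\<partial>z\<^sup>a)\<close> with respect to the frame \<open>\<partial>/\<partial>w\<^sup>i\<close>, i.e.
  \<open>axis i 1\<close> represents \<open>\<partial>/\<partial>w\<^sup>i\<close>.\<close>

definition tangent_map ::
    "('a, 'm::finite) chart \<Rightarrow> ('b, 'n::finite) chart \<Rightarrow> ('a \<Rightarrow> 'b) \<Rightarrow> 'a \<Rightarrow> 'm \<Rightarrow> complex^'n"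
  where "tangent_map c d f q a = (\<Sum>i\<in>UNIV. map_pd c d f i a q *s axis i 1)"

definition pullback_metric ::
    "('a, 'm::finite) chart \<Rightarrow> ('b, 'n::finite) chart \<Rightarrow> ('b, 'n) metric \<Rightarrow> ('a \<Rightarrow> 'b) \<Rightarrow>
      'm \<Rightarrow> 'm \<Rightarrow> 'a \<Rightarrow> complex"
  where "pullback_metric c d h f a b q =
    (\<Sum>i\<in>UNIV. \<Sum>j\<in>UNIV. map_pd c d f i a q * cnj (map_pd c d f j b q) * h d (f q) $ i $ j)"

text \<open>Coordinates are numbered by \<open>\<mu> 1, \<dots>, \<mu> m\<close>, where \<open>\<mu>\<close> enumerates the index type.\<close>

definition U_fun ::
    "(nat \<Rightarrow> 'm::finite) \<Rightarrow> nat \<Rightarrow> ('a, 'm) chart \<Rightarrow> ('b, 'n::finite) chart \<Rightarrow>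
      ('a, 'm) metric \<Rightarrow> ('b, 'n) metric \<Rightarrow> ('a \<Rightarrow> 'b) \<Rightarrow> 'a \<Rightarrow> complex"
  where "U_fun \<mu> l c d g h f q =
    (\<Sum>\<alpha>=1..l. \<Sum>\<beta>=1..l.
      metric_inv g c q (\<mu> \<alpha>) (\<mu> \<beta>) * pullback_metric c d h f (\<mu> \<alpha>) (\<mu> \<beta>) q)"


section \<open>The bundle \<open>E\<close>, the dual tangent bundle of the source tensored with the pulled-back tangent bundle\<close>

text \<open>Over the coordinate neighbourhood \<open>E\<close> has the holomorphic frame \<open>dz\<^sup>k \<otimes> e\<^sub>i\<close>. A vector in a fibre
  of \<open>E\<close> is represented by its components \<open>s k i\<close> and a section \<open>\<Sum>k i. s\<^sub>k\<^sup>i dz\<^sup>k \<otimes> e\<^sub>i\<close> by the component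
  functions \<open>s k i :: 'a \<Rightarrow> complex\<close>. The metric is the one induced by \<open>g\<close> and \<open>h\<close>, with
  \<open>\<langle>dz\<^sup>k, dz\<^sup>l\<rangle> = g\<^sup>k\<^sup>l\<close>.\<close>

definition E_inner ::
    "('a, 'm::finite) chart \<Rightarrow> ('b, 'n::finite) chart \<Rightarrow> ('a, 'm) metric \<Rightarrow> ('b, 'n) metric \<Rightarrow>
      ('a \<Rightarrow> 'b) \<Rightarrow> 'a \<Rightarrow> ('m \<Rightarrow> 'n \<Rightarrow> complex) \<Rightarrow> ('m \<Rightarrow> 'n \<Rightarrow> complex) \<Rightarrow> complex"
  where "E_inner c d g h f q s t =
    (\<Sum>k\<in>UNIV. \<Sum>l\<in>UNIV. \<Sum>i\<in>UNIV. \<Sum>j\<in>UNIV.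
      metric_inv g c q k l * h d (f q) $ i $ j * s k i * cnj (t l j))"

text \<open>Coefficients of the dual connection, \<open>\<nabla>\<^sub>a dz\<^sup>j = \<Sum>k. dual_connection g c a j k q \<cdot> dz\<^sup>k\<close>, and of the
  pull-back connection, \<open>\<nabla>\<^sub>a e\<^sub>i = \<Sum>j. pullback_connection c d h f a i j q \<cdot> e\<^sub>j\<close>.\<close>

definition dual_connection ::
    "('a, 'm::finite) metric \<Rightarrow> ('a, 'm) chart \<Rightarrow> 'm \<Rightarrow> 'm \<Rightarrow> 'm \<Rightarrow> 'a \<Rightarrow> complex"
  where "dual_connection g c a j k q = - chern_connection g c a k j q"

definition pullback_connection ::
    "('a, 'm::finite) chart \<Rightarrow> ('b, 'n::finite) chart \<Rightarrow> ('b, 'n) metric \<Rightarrow> ('a \<Rightarrow> 'b) \<Rightarrow>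
      'm \<Rightarrow> 'n \<Rightarrow> 'n \<Rightarrow> 'a \<Rightarrow> complex"
  where "pullback_connection c d h f a i j q =
    (\<Sum>k\<in>UNIV. map_pd c d f k a q * chern_connection h d k i j (f q))"

text \<open>\<open>E_nabla c d g h f a s q\<close> is \<open>\<nabla>\<^sub>a s\<close> at \<open>q\<close> for the tensor product connection, obtained from the
  Leibniz rule for \<open>\<Sum>k i. s\<^sub>k\<^sup>i dz\<^sup>k \<otimes> e\<^sub>i\<close>.\<close>

definition E_nabla ::
    "('a, 'm::finite) chart \<Rightarrow> ('b, 'n::finite) chart \<Rightarrow> ('a, 'm) metric \<Rightarrow> ('b, 'n) metric \<Rightarrow>
      ('a \<Rightarrow> 'b) \<Rightarrow> 'm \<Rightarrow> ('m \<Rightarrow> 'n \<Rightarrow> 'a \<Rightarrow> complex) \<Rightarrow> 'a \<Rightarrow> 'm \<Rightarrow> 'n \<Rightarrow> complex"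
  where "E_nabla c d g h f a s q k i =
    pd c a (s k i) q
    + (\<Sum>j\<in>UNIV. s j i q * dual_connection g c a j k q)
    + (\<Sum>j\<in>UNIV. s k j q * pullback_connection c d h f a j i q)"

text \<open>The section \<open>V\<^sub>l = \<Sum>\<alpha>=1..l. \<Sum>i. f\<^sup>i\<^sub>\<alpha> dz\<^sup>\<alpha> \<otimes> e\<^sub>i\<close>.\<close>

definition V_section ::
    "(nat \<Rightarrow> 'm::finite) \<Rightarrow> nat \<Rightarrow> ('a, 'm) chart \<Rightarrow> ('b, 'n::finite) chart \<Rightarrow> ('a \<Rightarrow> 'b) \<Rightarrow>
      'm \<Rightarrow> 'n \<Rightarrow> 'a \<Rightarrow> complex"
  where "V_section \<mu> l c d f k i q = (if k \<in> \<mu> ` {1..l} then map_pd c d f i k q else 0)"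


section \<open>Forms of type \<open>(1,1)\<close>\<close>

text \<open>Complex-valued 2-forms at a point are functions of two real tangent vectors, which a chart
  identifies with elements of \<open>\<complex>\<^sup>m\<close>. \<open>dz_dzbar a b\<close> is \<open>dz\<^sup>a \<and> dzb\<^sup>b\<close>.\<close>

definition dz_dzbar :: "'m::finite \<Rightarrow> 'm \<Rightarrow> complex^'m \<Rightarrow> complex^'m \<Rightarrow> complex"
  where "dz_dzbar a b u v = u $ a * cnj (v $ b) - v $ a * cnj (u $ b)"

text \<open>\<open>form11 C = \<Sum>a b. C\<^sub>a\<^sub>b dz\<^sup>a \<and> dzb\<^sup>b\<close>.\<close>

definition form11 :: "('m::finite \<Rightarrow> 'm \<Rightarrow> complex) \<Rightarrow> complex^'m \<Rightarrow> complex^'m \<Rightarrow> complex"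
  where "form11 C u v = (\<Sum>a\<in>UNIV. \<Sum>b\<in>UNIV. C a b * dz_dzbar a b u v)"

definition del_delbar ::
    "('a, 'm::finite) chart \<Rightarrow> ('a \<Rightarrow> complex) \<Rightarrow> 'a \<Rightarrow> complex^'m \<Rightarrow> complex^'m \<Rightarrow> complex"
  where "del_delbar c F q = form11 (\<lambda>a b. pd c a (pd_bar c b F) q)"

text \<open>\<open>\<langle>\<nabla>s, \<nabla>s\<rangle> = \<Sum>a b. \<langle>\<nabla>\<^sub>a s, \<nabla>\<^sub>b s\<rangle> dz\<^sup>a \<and> dzb\<^sup>b\<close>.\<close>

definition nabla_form ::
    "('a, 'm::finite) chart \<Rightarrow> ('b, 'n::finite) chart \<Rightarrow> ('a, 'm) metric \<Rightarrow> ('b, 'n) metric \<Rightarrow>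
      ('a \<Rightarrow> 'b) \<Rightarrow> ('m \<Rightarrow> 'n \<Rightarrow> 'a \<Rightarrow> complex) \<Rightarrow> 'a \<Rightarrow> complex^'m \<Rightarrow> complex^'m \<Rightarrow> complex"
  where "nabla_form c d g h f s q =
    form11 (\<lambda>a b. E_inner c d g h f q (E_nabla c d g h f a s q) (E_nabla c d g h f b s q))"

end

theory Submission
  imports Defs "HOL-Complex_Analysis.Cauchy_Integral_Formula"
begin

text \<open>\<open>U\<^sub>l\<close> is the squared norm \<open>\<langle>V\<^sub>l, V\<^sub>l\<rangle>\<close> of the section \<open>V\<^sub>l\<close> of \<open>E\<close>, whose components are holomorphic
  because partial derivatives of holomorphic functions are holomorphic. The formula is therefore the
  Bochner identity \<open>\<partial>\<^sub>a\<partial>\<^sub>b \<langle>V, V\<rangle> = \<langle>\<nabla>\<^sub>a V, \<nabla>\<^sub>b V\<rangle> - \<langle>R\<^sup>E(a, b) V, V\<rangle>\<close> (with \<open>b\<close> barred). Here it is obtained by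
  differentiating \<open>\<Sum> g\<^sup>k\<^sup>l V\<^sub>k\<^sup>i cnj(V\<^sub>l\<^sup>j) h\<^sub>i\<^sub>j\<close> twice at a point where both metrics are the identity: the term
  \<open>g\<^sup>-\<^sup>1 (\<partial>g) g\<^sup>-\<^sup>1 (\<partial>g) g\<^sup>-\<^sup>1\<close> occurs twice in the second derivative of the inverse metric, once inside the curvature of
  \<open>g\<close> and once inside \<open>\<langle>\<nabla>V, \<nabla>V\<rangle>\<close>. The diagonal form of \<open>\<partial>f\<close> then collapses the curvature sums.\<close>

section \<open>Wirtinger calculus\<close>

text \<open>The coordinates are not normalised to first order: at \<open>p\<close> only the values
  of \<open>g\<close> and \<open>h\<close> are the identity. Their first derivatives therefore
  survive in all cross terms, and exactly these terms complete the first derivatives of V to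
  \<nabla>V. The truncation at \<open>l\<close> is handled by extending the components of V by 0
  over the remaining indices. Zero is holomorphic, so the sums up to \<open>l\<close> become sums
  over the whole index type, paired by the inverse of the full matrix of \<open>g\<close>; \<nabla>V
  may nevertheless have components with index beyond \<open>l\<close>. The analytic obstacle is that
  holomorphy is given only as pointwise complex differentiability, while the second derivative of
  f^i_a conj(f^j_b) requires f^i_a to be differentiable again with vanishing conjugate derivatives.
  Cauchy integrals over small circles supply this. Likewise the inverse metric is given only as a
  pointwise matrix inverse: its differentiability comes from Cramer's rule, its derivatives from
  differentiating the product of the matrix and its inverse.\<close>

lemma wirtinger_eqI:
  assumes "(F has_derivative L) (at x)"
  shows "wirtinger a F x = (L (axis a 1) - \<i> * L (axis a \<i>)) / 2"
    and "wirtinger_bar a F x = (L (axis a 1) + \<i> * L (axis a \<i>)) / 2"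
  using frechet_derivative_at[OF assms] by (simp_all add: wirtinger_def wirtinger_bar_def)

text \<open>Splitting every coordinate into real and imaginary part and regrouping separates the
  complex-linear part of \<open>L\<close> from the conjugate-linear one; the coefficients of the two
  parts are the Wirtinger expressions.\<close>

lemma linear_wirtinger_expansion:
  fixes L :: "complex^'m::finite \<Rightarrow> complex"
  assumes "linear L"
  shows "L v = (\<Sum>a\<in>UNIV. (L (axis a 1) - \<i> * L (axis a \<i>)) / 2 * v $ a
                         + (L (axis a 1) + \<i> * L (axis a \<i>)) / 2 * cnj (v $ a))"
proof -
  have ax: "axis a c = Re c *\<^sub>R axis a 1 + Im c *\<^sub>R axis a \<i>" for a :: 'm and c
    by (auto simp: vec_eq_iff axis_def complex_eq_iff)
  have "v = (\<Sum>a\<in>UNIV. axis a (v $ a))"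
    by (simp add: vec_eq_iff axis_def)
  then have "L v = (\<Sum>a\<in>UNIV. L (axis a (v $ a)))"
    using linear_sum[OF assms] by metis
  also have "\<dots> = (\<Sum>a\<in>UNIV. Re (v $ a) *\<^sub>R L (axis a 1) + Im (v $ a) *\<^sub>R L (axis a \<i>))"
    by (subst ax) (simp add: linear_add[OF assms] linear_scale[OF assms])
  also have "\<dots> = (\<Sum>a\<in>UNIV. (L (axis a 1) - \<i> * L (axis a \<i>)) / 2 * v $ a
                         + (L (axis a 1) + \<i> * L (axis a \<i>)) / 2 * cnj (v $ a))"
    by (intro sum.cong refl) (auto simp: complex_eq_iff field_simps)
  finally show ?thesis .
qed

lemma frechet_derivative_wirtinger:
  assumes "F differentiable (at x)"
  shows "frechet_derivative F (at x) v =
    (\<Sum>a\<in>UNIV. wirtinger a F x * v $ a + wirtinger_bar a F x * cnj (v $ a))"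
proof -
  have "linear (frechet_derivative F (at x))"
    using assms by (simp add: linear_frechet_derivative)
  from linear_wirtinger_expansion[OF this, of v] show ?thesis
    by (simp add: wirtinger_def wirtinger_bar_def)
qed

text \<open>Second derivatives apply \<open>wirtinger\<close> to functions such as
  \<open>wirtinger_bar b F\<close>, whose closed form is known only near the point. Agreement on an
  open set is all that a derivative sees.\<close>

lemma wirtinger_cong:
  assumes "open S" "x \<in> S" "\<And>y. y \<in> S \<Longrightarrow> F y = G y"
  shows "wirtinger a F x = wirtinger a G x" "wirtinger_bar a F x = wirtinger_bar a G x"
proof -
  have "(F has_derivative L) (at x) \<longleftrightarrow> (G has_derivative L) (at x)" for L
    using has_derivative_transform_within_open[of _ L x UNIV S] assms by metis
  then have "frechet_derivative F (at x) = frechet_derivative G (at x)"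
    by (simp add: frechet_derivative_def)
  then show "wirtinger a F x = wirtinger a G x" "wirtinger_bar a F x = wirtinger_bar a G x"
    by (simp_all add: wirtinger_def wirtinger_bar_def)
qed

lemma wirtinger_const [simp]: "wirtinger a (\<lambda>y. c) x = 0" "wirtinger_bar a (\<lambda>y. c) x = 0"
  by (simp_all add: wirtinger_eqI[OF has_derivative_const])

lemma wirtinger_mult:
  assumes "F differentiable (at x)" "G differentiable (at x)"
  shows "wirtinger a (\<lambda>y. F y * G y) x = wirtinger a F x * G x + F x * wirtinger a G x"
    "wirtinger_bar a (\<lambda>y. F y * G y) x = wirtinger_bar a F x * G x + F x * wirtinger_bar a G x"
proof -
  have "((\<lambda>y. F y * G y) has_derivative
      (\<lambda>v. F x * frechet_derivative G (at x) v + frechet_derivative F (at x) v * G x)) (at x)"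
    using assms by (intro has_derivative_mult) (auto simp: frechet_derivative_works)
  note * = wirtinger_eqI[OF this]
  show "wirtinger a (\<lambda>y. F y * G y) x = wirtinger a F x * G x + F x * wirtinger a G x"
    "wirtinger_bar a (\<lambda>y. F y * G y) x = wirtinger_bar a F x * G x + F x * wirtinger_bar a G x"
    unfolding * by (simp_all add: wirtinger_def wirtinger_bar_def field_simps)
qed

lemma wirtinger_add:
  assumes "F differentiable (at x)" "G differentiable (at x)"
  shows "wirtinger a (\<lambda>y. F y + G y) x = wirtinger a F x + wirtinger a G x"
    "wirtinger_bar a (\<lambda>y. F y + G y) x = wirtinger_bar a F x + wirtinger_bar a G x"
proof -
  have "((\<lambda>y. F y + G y) has_derivative
      (\<lambda>v. frechet_derivative F (at x) v + frechet_derivative G (at x) v)) (at x)"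
    using assms by (intro has_derivative_add) (auto simp: frechet_derivative_works)
  note * = wirtinger_eqI[OF this]
  show "wirtinger a (\<lambda>y. F y + G y) x = wirtinger a F x + wirtinger a G x"
    "wirtinger_bar a (\<lambda>y. F y + G y) x = wirtinger_bar a F x + wirtinger_bar a G x"
    unfolding * by (simp_all add: wirtinger_def wirtinger_bar_def field_simps)
qed

lemma wirtinger_uminus:
  assumes "F differentiable (at x)"
  shows "wirtinger a (\<lambda>y. - F y) x = - wirtinger a F x"
    "wirtinger_bar a (\<lambda>y. - F y) x = - wirtinger_bar a F x"
  using wirtinger_mult[of "\<lambda>_. -1" x F] assms by simp_all

lemma wirtinger_sum:
  assumes "\<And>i. i \<in> I \<Longrightarrow> F i differentiable (at x)"
  shows "wirtinger a (\<lambda>y. \<Sum>i\<in>I. F i y) x = (\<Sum>i\<in>I. wirtinger a (F i) x)"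
    "wirtinger_bar a (\<lambda>y. \<Sum>i\<in>I. F i y) x = (\<Sum>i\<in>I. wirtinger_bar a (F i) x)"
proof -
  have "((\<lambda>y. \<Sum>i\<in>I. F i y) has_derivative (\<lambda>v. \<Sum>i\<in>I. frechet_derivative (F i) (at x) v)) (at x)"
    using assms by (intro has_derivative_sum) (auto simp: frechet_derivative_works)
  note * = wirtinger_eqI[OF this]
  show "wirtinger a (\<lambda>y. \<Sum>i\<in>I. F i y) x = (\<Sum>i\<in>I. wirtinger a (F i) x)"
    "wirtinger_bar a (\<lambda>y. \<Sum>i\<in>I. F i y) x = (\<Sum>i\<in>I. wirtinger_bar a (F i) x)"
    unfolding * by (simp_all add: wirtinger_def wirtinger_bar_def sum_distrib_left
        sum.distrib sum_subtractf flip: sum_divide_distrib)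
qed

lemma differentiable_cnj:
  assumes "F differentiable (at x)"
  shows "(\<lambda>y. cnj (F y)) differentiable (at x)"
  using assms has_derivative_cnj unfolding differentiable_def by blast

lemma wirtinger_cnj:
  assumes "F differentiable (at x)"
  shows "wirtinger a (\<lambda>y. cnj (F y)) x = cnj (wirtinger_bar a F x)"
    "wirtinger_bar a (\<lambda>y. cnj (F y)) x = cnj (wirtinger a F x)"
proof -
  have "((\<lambda>y. cnj (F y)) has_derivative (\<lambda>v. cnj (frechet_derivative F (at x) v))) (at x)"
    using assms by (intro has_derivative_cnj) (auto simp: frechet_derivative_works)
  note * = wirtinger_eqI[OF this]
  show "wirtinger a (\<lambda>y. cnj (F y)) x = cnj (wirtinger_bar a F x)"
    "wirtinger_bar a (\<lambda>y. cnj (F y)) x = cnj (wirtinger a F x)"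
    unfolding * by (simp_all add: wirtinger_def wirtinger_bar_def)
qed

text \<open>The Cauchy-Riemann equations at a single point, phrased as vanishing conjugate
  derivatives so that the product and chain rules can discard terms directly. Continuity of the
  partial derivatives is not built in and has to be proved.\<close>

definition holo_at :: "(complex^'m::finite \<Rightarrow> complex) \<Rightarrow> complex^'m \<Rightarrow> bool"
  where "holo_at F x \<longleftrightarrow> F differentiable (at x) \<and> (\<forall>a. wirtinger_bar a F x = 0)"

lemma holo_atI:
  assumes "(F has_derivative L) (at x)" "\<And>c v. L (c *s v) = c * L v"
  shows "holo_at F x"
proof -
  have "L (axis a \<i>) = \<i> * L (axis a 1)" for a
  proof -
    have "axis a \<i> = \<i> *s axis a (1::complex)"
      by (simp add: vec_eq_iff axis_def)
    then show ?thesis using assms(2) by metis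
  qed
  then have "wirtinger_bar a F x = 0" for a
    using wirtinger_eqI(2)[OF assms(1), of a] by (simp flip: mult.assoc)
  then show ?thesis
    using assms(1) by (auto simp: holo_at_def differentiable_def)
qed

lemma holo_at_has_derivative:
  assumes "holo_at F x"
  shows "(F has_derivative (\<lambda>v. \<Sum>a\<in>UNIV. wirtinger a F x * v $ a)) (at x)"
proof -
  have "frechet_derivative F (at x) = (\<lambda>v. \<Sum>a\<in>UNIV. wirtinger a F x * v $ a)"
    using assms by (simp add: fun_eq_iff frechet_derivative_wirtinger holo_at_def)
  with assms show ?thesis
    by (metis frechet_derivative_works holo_at_def)
qed

text \<open>The derivative of a holomorphic map is complex linear, so it has no coefficients linking
  barred with unbarred directions. Each operator therefore meets only the operator of its own type
  on \<open>F\<close>, although \<open>F\<close> is merely real differentiable.\<close>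

lemma wirtinger_chain:
  fixes \<phi> :: "complex^'m::finite \<Rightarrow> complex^'n::finite"
  assumes \<phi>: "\<And>i. holo_at (\<lambda>y. \<phi> y $ i) x" and F: "F differentiable (at (\<phi> x))"
  shows "(\<lambda>y. F (\<phi> y)) differentiable (at x)"
    "wirtinger a (\<lambda>y. F (\<phi> y)) x = (\<Sum>i\<in>UNIV. wirtinger a (\<lambda>y. \<phi> y $ i) x * wirtinger i F (\<phi> x))"
    "wirtinger_bar a (\<lambda>y. F (\<phi> y)) x =
      (\<Sum>i\<in>UNIV. cnj (wirtinger a (\<lambda>y. \<phi> y $ i) x) * wirtinger_bar i F (\<phi> x))"
proof -
  let ?L = "\<lambda>v. \<chi> i. \<Sum>a\<in>UNIV. wirtinger a (\<lambda>y. \<phi> y $ i) x * v $ a"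
  have "(\<phi> has_derivative ?L) (at x)"
    unfolding has_derivative_componentwise_within[of \<phi>]
  proof
    fix b :: "complex^'n" assume "b \<in> Basis"
    then obtain i c where b: "b = axis i c" by (auto simp: Basis_vec_def)
    have "((\<lambda>y. \<phi> y $ i \<bullet> c) has_derivative (\<lambda>v. ?L v $ i \<bullet> c)) (at x)"
      using has_derivative_inner_left[OF holo_at_has_derivative[OF \<phi>[of i]]] by simp
    then show "((\<lambda>y. \<phi> y \<bullet> b) has_derivative (\<lambda>v. ?L v \<bullet> b)) (at x)"
      unfolding b inner_axis .
  qed
  then have D: "((\<lambda>y. F (\<phi> y)) has_derivative (\<lambda>v. frechet_derivative F (at (\<phi> x)) (?L v))) (at x)"
    using F has_derivative_compose[of \<phi> ?L x UNIV F] by (simp add: frechet_derivative_works)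
  then show "(\<lambda>y. F (\<phi> y)) differentiable (at x)"
    by (auto simp: differentiable_def)
  have ax: "?L (axis a c) = (\<chi> i. wirtinger a (\<lambda>y. \<phi> y $ i) x * c)" for c
    by (simp add: vec_eq_iff axis_def if_distrib cong: if_cong)
  show "wirtinger a (\<lambda>y. F (\<phi> y)) x =
      (\<Sum>i\<in>UNIV. wirtinger a (\<lambda>y. \<phi> y $ i) x * wirtinger i F (\<phi> x))"
    "wirtinger_bar a (\<lambda>y. F (\<phi> y)) x =
      (\<Sum>i\<in>UNIV. cnj (wirtinger a (\<lambda>y. \<phi> y $ i) x) * wirtinger_bar i F (\<phi> x))"
    unfolding wirtinger_eqI[OF D] ax frechet_derivative_wirtinger[OF F]
    by (simp_all add: sum_distrib_left sum_subtractf[symmetric] sum.distrib[symmetric] sum_divide_distrib)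
       (intro sum.cong refl; simp add: algebra_simps)+
qed

section \<open>Partial derivatives of holomorphic functions\<close>

text \<open>Restriction to a complex line parallel to a coordinate axis turns a partial derivative
  into a derivative in one complex variable, for which Cauchy's formula is available.\<close>

lemma holo_at_line:
  assumes "holo_at F (x + \<zeta> *s axis a 1)"
  shows "((\<lambda>\<zeta>. F (x + \<zeta> *s axis a 1)) has_field_derivative wirtinger a F (x + \<zeta> *s axis a 1)) (at \<zeta>)"
proof -
  have "((\<lambda>\<zeta>::complex. x + \<zeta> *s axis a 1) has_derivative (\<lambda>c. c *s axis a 1)) (at \<zeta>)"
  proof -
    have "bounded_linear (\<lambda>c::complex. c *s (axis a 1 :: complex^'a))"
      by (intro linear_conv_bounded_linear[THEN iffD1] linearI) (auto simp: vec_eq_iff algebra_simps)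
    then show ?thesis
      by (auto intro!: derivative_eq_intros bounded_linear_imp_has_derivative)
  qed
  from has_derivative_compose[OF this holo_at_has_derivative[OF assms]]
  have "((\<lambda>\<zeta>. F (x + \<zeta> *s axis a 1)) has_derivative
      (\<lambda>c. \<Sum>b\<in>UNIV. wirtinger b F (x + \<zeta> *s axis a 1) * (c *s axis a 1) $ b)) (at \<zeta>)" .
  moreover have "(\<lambda>c. \<Sum>b\<in>UNIV. wirtinger b F (x + \<zeta> *s axis a 1) * (c *s axis a 1) $ b)
      = (*) (wirtinger a F (x + \<zeta> *s axis a 1))"
    by (simp add: fun_eq_iff axis_def if_distrib cong: if_cong)
  ultimately show ?thesis
    by (simp add: has_field_derivative_def)
qed

text \<open>The partial derivative is a Cauchy integral over a circle whose radius is independent of the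
  base point, so it can be differentiated under the integral sign.\<close>

lemma wirtinger_circle_integral:
  assumes r: "0 < r" and F: "\<And>\<zeta>. cmod \<zeta> \<le> r \<Longrightarrow> holo_at F (x + \<zeta> *s axis a 1)"
  shows "wirtinger a F x =
    integral {0..1} (\<lambda>t. F (x + (r * exp (2 * of_real pi * \<i> * of_real t)) *s axis a 1) *
      (exp (- (2 * of_real pi * \<i> * of_real t)) / r))"
proof -
  let ?f = "\<lambda>\<zeta>. F (x + \<zeta> *s axis a 1)"
  note D = holo_at_line[OF F]
  have c: "continuous_on (cball 0 r) ?f"
    by (rule DERIV_continuous_on) (use D in \<open>auto intro: has_field_derivative_at_within\<close>)
  have h: "?f holomorphic_on ball 0 r"
    unfolding holomorphic_on_def field_differentiable_def
    using has_field_derivative_at_within[OF D] by (metis less_imp_le mem_ball_0)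
  have "deriv ?f 0 = wirtinger a F x"
    using DERIV_imp_deriv[OF D[of 0]] r by simp
  then have 1: "(2 * pi * \<i>) * wirtinger a F x = contour_integral (circlepath 0 r) (\<lambda>u. ?f u / (u - 0)\<^sup>2)"
    using Cauchy_contour_integral_circlepath_2[OF c h, of 0] r by simp
  have 2: "contour_integral (circlepath 0 r) (\<lambda>u. ?f u / (u - 0)\<^sup>2) = integral {0..1} (\<lambda>t. (2 * pi * \<i>) * (?f (r * exp (2 * of_real pi * \<i> * of_real t)) *
      (exp (- (2 * of_real pi * \<i> * of_real t)) / r)))"
    unfolding contour_integral_integral vector_derivative_circlepath
    unfolding circlepath
  proof (intro integral_cong)
    fix t :: real
    define E where "E = exp (2 * of_real pi * \<i> * of_real t)"
    have [simp]: "E \<noteq> 0" "complex_of_real r \<noteq> 0" using r by (auto simp: E_def)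
    \<comment> \<open>On the circle u = rE with du = 2 pi i r E dt, so du / u^2 equals 2 pi i / (r
      E) dt. The factor 2 pi i later cancels against the one in Cauchy's formula for the first
      derivative.\<close>
    have "Y / (0 + r * E - 0)\<^sup>2 * (2 * pi * \<i> * r * E) = (2 * pi * \<i>) * (Y * (inverse E / r))" for Y
      by (simp add: power2_eq_square field_simps)
    then show "?f (0 + r * exp (2 * of_real pi * \<i> * of_real t)) / (0 + r * exp (2 * of_real pi * \<i> * of_real t) - 0)\<^sup>2 *
        (2 * pi * \<i> * r * exp (2 * of_real pi * \<i> * of_real t)) =
      (2 * pi * \<i>) * (?f (r * exp (2 * of_real pi * \<i> * of_real t)) *
        (exp (- (2 * of_real pi * \<i> * of_real t)) / r))"
      unfolding exp_minus E_def[symmetric] by simp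
  qed
  have "(2 * pi * \<i>) * wirtinger a F x = (2 * pi * \<i>) * integral {0..1}
      (\<lambda>t. ?f (r * exp (2 * of_real pi * \<i> * of_real t)) *
        (exp (- (2 * of_real pi * \<i> * of_real t)) / r))"
    unfolding 1 2 integral_mult_right ..
  moreover have "2 * pi * \<i> \<noteq> 0"
    by simp
  ultimately show ?thesis
    unfolding mult_cancel_left by blast
qed

section \<open>Circles of uniform radius and continuity of the Cauchy integrand\<close>

lemma norm_axis_complex: "norm (axis b \<zeta> :: complex^'m::finite) = cmod \<zeta>"
proof -
  have "(\<Sum>i\<in>UNIV. (cmod ((axis b \<zeta> :: complex^'m) $ i))\<^sup>2) = (cmod \<zeta>)\<^sup>2"
    by (simp add: axis_def if_distrib[of cmod] if_distrib[of "\<lambda>u. u\<^sup>2"] cong: if_cong)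
  then show ?thesis by (simp add: norm_vec_def L2_set_def)
qed

lemma norm_scale_axis [simp]: "norm (\<zeta> *s (axis b 1 :: complex^'m::finite)) = cmod \<zeta>"
proof -
  have "\<zeta> *s (axis b 1 :: complex^'m) = axis b \<zeta>" by (simp add: vec_eq_iff axis_def)
  then show ?thesis by (simp add: norm_axis_complex)
qed

text \<open>One radius must serve all base points near \<open>x0\<close>, since the circle stays
  fixed while the base point moves. Half the radius of a closed ball inside \<open>S\<close>
  suffices: the displacement of the base point and the circle use one half each.\<close>

lemma ball_line_subset:
  fixes S :: "(complex^'m::finite) set"
  assumes "open S" "x0 \<in> S"
  obtains r where "r > 0" "\<And>x \<zeta> b. x \<in> cball x0 r \<Longrightarrow> cmod \<zeta> \<le> r \<Longrightarrow> x + \<zeta> *s axis b 1 \<in> S"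
proof -
  obtain R where R: "R > 0" "cball x0 R \<subseteq> S"
    using assms open_contains_cball by blast
  show ?thesis
  proof (rule that[of "R / 2"])
    fix x :: "complex^'m" and \<zeta> b assume "x \<in> cball x0 (R / 2)" "cmod \<zeta> \<le> R / 2"
    moreover have "dist x0 (x + \<zeta> *s axis b 1) \<le> dist x0 x + cmod \<zeta>"
      using norm_triangle_ineq[of "x - x0" "\<zeta> *s axis b 1"]
      by (simp add: dist_norm norm_minus_commute algebra_simps)
    ultimately show "x + \<zeta> *s axis b 1 \<in> S"
      using R by (auto intro!: subsetD[OF R(2)])
  qed (use R in auto)
qed

text \<open>Joint continuity in base point and angle is what differentiation under the integral sign
  demands. \<open>G\<close> is kept general because the result is applied to a function and also to
  its partial derivatives.\<close>

lemma continuous_on_circle_translate: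
  fixes G :: "complex^'m::finite \<Rightarrow> complex"
  assumes r: "0 < r" and S: "\<And>x \<zeta>. x \<in> T \<Longrightarrow> cmod \<zeta> \<le> r \<Longrightarrow> x + \<zeta> *s axis b 1 \<in> S"
    and G: "continuous_on S G"
  shows "continuous_on (T \<times> cbox 0 (1::real))
    (\<lambda>(x, t). G (x + (r * exp (2 * of_real pi * \<i> * of_real t)) *s axis b 1) *
      (exp (- (2 * of_real pi * \<i> * of_real t)) / r))"
proof -
  have P: "continuous_on (T \<times> cbox 0 (1::real))
      (\<lambda>p. fst p + (r * exp (2 * of_real pi * \<i> * of_real (snd p))) *s (axis b 1 :: complex^'m))"
    unfolding vector_scalar_mult_def by (intro continuous_intros continuous_on_vec_lambda)
  have "continuous_on (T \<times> cbox 0 (1::real))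
      (\<lambda>p. G (fst p + (r * exp (2 * of_real pi * \<i> * of_real (snd p))) *s axis b 1))"
    by (rule continuous_on_compose2[OF G P]) (use r in \<open>auto intro!: S simp: norm_mult\<close>)
  then show ?thesis
    unfolding split_beta using r by (intro continuous_intros) auto
qed

text \<open>Holomorphy at each point does not by itself say that the partial derivatives are
  continuous. The circle integral depends continuously on its base point and supplies this, as
  needed for the derivative of the integrand in \<open>leibniz_rule\<close>.\<close>

lemma continuous_on_wirtinger:
  fixes F :: "complex^'m::finite \<Rightarrow> complex"
  assumes S: "open S" and F: "\<And>x. x \<in> S \<Longrightarrow> holo_at F x"
  shows "continuous_on S (wirtinger b F)"
proof (rule continuous_at_imp_continuous_on, rule ballI)
  fix x0 assume "x0 \<in> S"
  then obtain r where r: "r > 0"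
    and in_S: "\<And>x \<zeta> b. x \<in> cball x0 r \<Longrightarrow> cmod \<zeta> \<le> r \<Longrightarrow> x + \<zeta> *s axis b 1 \<in> S"
    using ball_line_subset[OF S] by metis
  have "continuous_on S F"
    using F by (auto simp: holo_at_def intro!: continuous_at_imp_continuous_on differentiable_imp_continuous_within)
  from integral_continuous_on_param[OF continuous_on_circle_translate[OF r in_S this, of "cball x0 r" b]]
  have *: "continuous_on (cball x0 r) (\<lambda>x. integral {0..1}
      (\<lambda>t. F (x + (r * exp (2 * of_real pi * \<i> * of_real t)) *s axis b 1) *
        (exp (- (2 * of_real pi * \<i> * of_real t)) / r)))"
    unfolding box_real(2) by blast
  have "continuous_on (cball x0 r) (wirtinger b F)"
    by (rule continuous_on_eq[OF *]) (rule wirtinger_circle_integral[symmetric, OF r F[OF in_S]])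
  then show "isCont (wirtinger b F) x0"
    by (rule continuous_on_interior) (simp add: r)
qed

text \<open>In the Cauchy integral only \<open>F\<close> depends on the base point, and its
  derivative is complex linear. Integration over the circle preserves complex linearity, so the
  partial derivative satisfies the Cauchy-Riemann equations again.\<close>

lemma holo_at_wirtinger:
  fixes F :: "complex^'m::finite \<Rightarrow> complex"
  assumes S: "open S" "x0 \<in> S" and F: "\<And>x. x \<in> S \<Longrightarrow> holo_at F x"
  shows "holo_at (wirtinger a F) x0"
proof -
  obtain r where r: "r > 0"
    and in_S: "\<And>x \<zeta> b. x \<in> cball x0 r \<Longrightarrow> cmod \<zeta> \<le> r \<Longrightarrow> x + \<zeta> *s axis b 1 \<in> S"
    using ball_line_subset[OF S] by metis
  define P where "P = (\<lambda>t::real. (r * exp (2 * of_real pi * \<i> * of_real t)) *s (axis a 1 :: complex^'m))"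
  define e where "e = (\<lambda>t::real. exp (- (2 * of_real pi * \<i> * of_real t)) / complex_of_real r)"
  have in_P: "x + P t \<in> S" if "x \<in> cball x0 r" for x t
    unfolding P_def using that r by (intro in_S) (auto simp: norm_mult)
  \<comment> \<open>\<open>leibniz_rule\<close> integrates the derivative as one operator, hence the
    bounded linear function. \<open>P t\<close> is the displacement along the circle and
    \<open>e t\<close> the weight in Cauchy's formula.\<close>
  define D where "D = (\<lambda>x t. Blinfun (\<lambda>v. \<Sum>b\<in>UNIV. wirtinger b F (x + P t) * e t * v $ b))"
  have D: "blinfun_apply (D x t) = (\<lambda>v. \<Sum>b\<in>UNIV. wirtinger b F (x + P t) * e t * v $ b)" for x t
    unfolding D_def
    by (rule bounded_linear_Blinfun_apply)
       (intro bounded_linear_sum bounded_linear_const_mult bounded_linear_vec_nth)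
  have contF: "continuous_on S F"
    using F by (auto simp: holo_at_def intro!: continuous_at_imp_continuous_on differentiable_imp_continuous_within)
  have contD: "continuous_on (cball x0 r \<times> cbox 0 1) (\<lambda>(x, t). D x t)"
  proof (rule continuous_on_blinfun_componentwise)
    fix i :: "complex^'m"
    have "continuous_on (cball x0 r \<times> cbox 0 1) (\<lambda>p. wirtinger b F (fst p + P (snd p)) * e (snd p))" for b
      using continuous_on_circle_translate[OF r in_S continuous_on_wirtinger[OF S(1) F]]
      unfolding P_def e_def split_beta by blast
    then show "continuous_on (cball x0 r \<times> cbox 0 1) (\<lambda>p. blinfun_apply (case p of (x, t) \<Rightarrow> D x t) i)"
      unfolding split_beta D by (rule continuous_on_sum[OF continuous_on_mult[OF _ continuous_on_const]])
  qed
  have pair: "continuous_on (cbox 0 1) (\<lambda>t. (x, t))" for x :: "complex^'m"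
    by (rule continuous_on_Pair[OF continuous_on_const continuous_on_id])
  have contDx: "continuous_on (cbox 0 1) (D x0)"
  proof -
    have "(\<lambda>t. (x0, t)) ` cbox 0 1 \<subseteq> cball x0 r \<times> cbox 0 1"
      using r by (intro image_subsetI) simp
    from continuous_on_compose2[OF contD pair this] show ?thesis
      unfolding split_conv .
  qed
  have int: "(\<lambda>t. F (x + P t) * e t) integrable_on cbox 0 1" if "x \<in> cball x0 r" for x
  proof (rule integrable_continuous)
    have "(\<lambda>t. (x, t)) ` cbox 0 1 \<subseteq> cball x0 r \<times> cbox 0 1"
      using that by (intro image_subsetI) simp
    from continuous_on_compose2[OF continuous_on_circle_translate[OF r in_S contF, of "cball x0 r" a] pair this]
    show "continuous_on (cbox 0 1) (\<lambda>t. F (x + P t) * e t)"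
      unfolding P_def e_def split_conv by blast
  qed
  have der: "((\<lambda>x. F (x + P t) * e t) has_derivative blinfun_apply (D x t)) (at x within cball x0 r)"
    if "x \<in> cball x0 r" for x t
  proof -
    have "((\<lambda>x. F (x + P t)) has_derivative (\<lambda>v. \<Sum>b\<in>UNIV. wirtinger b F (x + P t) * v $ b)) (at x)"
      by (rule has_derivative_compose[of "\<lambda>x. x + P t" "\<lambda>v. v" x UNIV F,
          OF _ holo_at_has_derivative[OF F[OF in_P[OF that]]]])
         (auto intro!: derivative_eq_intros)
    from has_derivative_mult_left[OF this, of "e t"]
    show ?thesis
      unfolding D sum_distrib_right
      by (rule has_derivative_at_withinI[THEN has_derivative_eq_rhs]) (simp add: mult_ac)
  qed
  have "((\<lambda>x. integral (cbox 0 1) (\<lambda>t. F (x + P t) * e t)) has_derivative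
      blinfun_apply (integral (cbox 0 1) (D x0))) (at x0 within cball x0 r)"
    by (rule leibniz_rule[OF der int contD]) (use r in auto)
  \<comment> \<open>The Leibniz rule differentiates within the closed ball; its centre is an
    interior point, so this is the full derivative.\<close>
  then have "((\<lambda>x. integral (cbox 0 1) (\<lambda>t. F (x + P t) * e t)) has_derivative
      blinfun_apply (integral (cbox 0 1) (D x0))) (at x0)"
    by (subst (asm) at_within_interior) (simp_all only: interior_cball centre_in_ball r)
  moreover have "integral (cbox 0 1) (\<lambda>t. F (x + P t) * e t) = wirtinger a F x" if "x \<in> ball x0 r" for x
    unfolding P_def e_def box_real(2)
    by (rule wirtinger_circle_integral[symmetric, OF r F[OF in_S]]) (use that in auto)
  ultimately have "(wirtinger a F has_derivative blinfun_apply (integral (cbox 0 1) (D x0))) (at x0)"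
    using has_derivative_transform_within_open[OF _ open_ball centre_in_ball[THEN iffD2, OF r]]
    by blast
  moreover have "blinfun_apply (integral (cbox 0 1) (D x0)) (c *s v)
      = c * blinfun_apply (integral (cbox 0 1) (D x0)) v" for c v
  proof -
    have "blinfun_apply (D x0 t) (c *s v) = c * blinfun_apply (D x0 t) v" for t
      unfolding D sum_distrib_left by (intro sum.cong refl) simp
    then show ?thesis
      unfolding blinfun_apply_integral[OF integrable_continuous[OF contDx]] by simp
  qed
  ultimately show ?thesis
    by (rule holo_atI)
qed

section \<open>Second derivatives of inverse matrices and products\<close>

lemma differentiable_cong_open:
  assumes "open S" "x \<in> S" "\<And>y. y \<in> S \<Longrightarrow> F y = G y" "F differentiable (at x)"
  shows "G differentiable (at x)"
  using assms has_derivative_transform_within_open[of F _ x UNIV S G]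
  unfolding differentiable_def by blast

section \<open>Derivatives of an inverse matrix\<close>

lemma matrix_inv_inverse:
  fixes A :: "complex^'n::finite^'n"
  assumes "det A \<noteq> 0"
  shows "A ** matrix_inv A = mat 1" "matrix_inv A ** A = mat 1"
proof -
  have "\<exists>B. A ** B = mat 1 \<and> B ** A = mat 1"
    using assms by (simp add: invertible_def flip: invertible_det_nz)
  then show "A ** matrix_inv A = mat 1" "matrix_inv A ** A = mat 1"
    unfolding matrix_inv_def by (rule someI2_ex, simp)+
qed

lemma differentiable_det:
  fixes A :: "'a::real_normed_vector \<Rightarrow> complex^'n::finite^'n"
  assumes "\<And>i j. (\<lambda>x. A x $ i $ j) differentiable (at x)"
  shows "(\<lambda>x. det (A x)) differentiable (at x)"
proof -
  have "(\<lambda>x. \<Prod>i\<in>I. A x $ i $ \<sigma> i) differentiable (at x)" for \<sigma> :: "'n \<Rightarrow> 'n" and I :: "'n set"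
  proof -
    have "((\<lambda>x. \<Prod>i\<in>I. A x $ i $ \<sigma> i) has_derivative
        (\<lambda>y. \<Sum>i\<in>I. frechet_derivative (\<lambda>x. A x $ i $ \<sigma> i) (at x) y * (\<Prod>j\<in>I - {i}. A x $ j $ \<sigma> j))) (at x)"
      using assms by (intro has_derivative_prod) (simp add: frechet_derivative_works)
    then show ?thesis by (auto simp: differentiable_def)
  qed
  then show ?thesis
    unfolding det_def by (intro differentiable_sum ballI differentiable_mult differentiable_const) auto
qed

text \<open>Column \<open>l\<close> of the inverse solves the linear system with right-hand side
  \<open>axis l 1\<close>. Cramer's rule then exhibits each entry as a quotient of polynomials in
  the entries of \<open>A\<close>, from which differentiability can be read off.\<close>

lemma matrix_inv_cramer:
  fixes A :: "complex^'n::finite^'n"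
  assumes "det A \<noteq> 0"
  shows "matrix_inv A $ k $ l = det (\<chi> i j. if j = k then axis l 1 $ i else A $ i $ j) / det A"
proof -
  have "A ** matrix_inv A = mat 1"
    using assms by (rule matrix_inv_inverse)
  then have "A *v column l (matrix_inv A) = axis l 1"
    by (simp add: vec_eq_iff matrix_matrix_mult_def matrix_vector_mult_def column_def mat_def axis_def)
  then have "column l (matrix_inv A) = (\<chi> k. det (\<chi> i j. if j = k then axis l 1 $ i else A $ i $ j) / det A)"
    by (rule cramer[OF assms, THEN iffD1])
  then show ?thesis
    by (simp add: vec_eq_iff column_def)
qed

lemma differentiable_matrix_inv:
  fixes A :: "complex^'m::finite \<Rightarrow> complex^'n::finite^'n"
  assumes S: "open S" "x \<in> S" and nz: "\<And>y. y \<in> S \<Longrightarrow> det (A y) \<noteq> 0"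
    and A: "\<And>i j. (\<lambda>y. A y $ i $ j) differentiable (at x)"
  shows "(\<lambda>y. matrix_inv (A y) $ k $ l) differentiable (at x)"
proof (rule differentiable_cong_open[OF S])
  have "(\<lambda>y. (\<chi> i j. if j = k then axis l 1 $ i else A y $ i $ j) $ i $ j) differentiable (at x)" for i j
    using A by (cases "j = k") simp_all
  then have "(\<lambda>y. det (\<chi> i j. if j = k then axis l 1 $ i else A y $ i $ j)) differentiable (at x)"
    by (rule differentiable_det)
  then show "(\<lambda>y. det (\<chi> i j. if j = k then axis l 1 $ i else A y $ i $ j) / det (A y)) differentiable (at x)"
    by (rule differentiable_divide[OF _ differentiable_det[OF A] nz[OF S(2)]])
  show "det (\<chi> i j. if j = k then axis l 1 $ i else A y $ i $ j) / det (A y) = matrix_inv (A y) $ k $ l"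
    if "y \<in> S" for y
    using matrix_inv_cramer[OF nz[OF that]] by simp
qed

text \<open>The product of \<open>A\<close> and its inverse is constant on \<open>S\<close>.
  Differentiating it by the product rule gives a linear equation for the derivative of the inverse,
  solved by multiplying with the inverse from the left.\<close>

lemma wirtinger_matrix_inv:
  fixes A :: "complex^'m::finite \<Rightarrow> complex^'n::finite^'n"
  assumes S: "open S" "x \<in> S" and nz: "\<And>y. y \<in> S \<Longrightarrow> det (A y) \<noteq> 0"
    and A: "\<And>i j. (\<lambda>y. A y $ i $ j) differentiable (at x)"
  shows "wirtinger a (\<lambda>y. matrix_inv (A y) $ k $ l) x =
      - (\<Sum>s\<in>UNIV. \<Sum>t\<in>UNIV. matrix_inv (A x) $ k $ s * wirtinger a (\<lambda>y. A y $ s $ t) x * matrix_inv (A x) $ t $ l)"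
    and "wirtinger_bar a (\<lambda>y. matrix_inv (A y) $ k $ l) x =
      - (\<Sum>s\<in>UNIV. \<Sum>t\<in>UNIV. matrix_inv (A x) $ k $ s * wirtinger_bar a (\<lambda>y. A y $ s $ t) x * matrix_inv (A x) $ t $ l)"
proof -
  let ?J = "\<lambda>y. matrix_inv (A y)"
  note J = differentiable_matrix_inv[OF S nz A]
  have inv: "?J y ** A y = mat 1" "A y ** ?J y = mat 1" if "y \<in> S" for y
    using nz[OF that] by (simp_all add: matrix_inv_inverse)
  have AJ: "(\<Sum>s\<in>UNIV. A y $ t $ s * ?J y $ s $ l) = (if t = l then 1 else 0)" if "y \<in> S" for y t l
    using inv(2)[OF that] by (simp add: vec_eq_iff matrix_matrix_mult_def mat_def)
  have JA: "(\<Sum>s\<in>UNIV. ?J x $ k $ s * A x $ s $ t) = (if k = t then 1 else 0)" for k t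
    using inv(1)[OF S(2)] by (simp add: vec_eq_iff matrix_matrix_mult_def mat_def)
  \<comment> \<open>Stated for arbitrary \<open>D\<close> and \<open>d\<close>, so that the same
    linear algebra serves both Wirtinger operators.\<close>
  have solve: "d k l = - (\<Sum>s\<in>UNIV. \<Sum>t\<in>UNIV. ?J x $ k $ s * D s t * ?J x $ t $ l)"
    if "\<And>s. (\<Sum>t\<in>UNIV. D s t * ?J x $ t $ l + A x $ s $ t * d t l) = 0" for D d and k l :: 'n
  proof -
    have "(\<Sum>t\<in>UNIV. A x $ s $ t * d t l) = - (\<Sum>t\<in>UNIV. D s t * ?J x $ t $ l)" for s
      using that[of s] by (simp add: sum.distrib add_eq_0_iff)
    then have "(\<Sum>s\<in>UNIV. ?J x $ k $ s * (\<Sum>t\<in>UNIV. A x $ s $ t * d t l))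
        = - (\<Sum>s\<in>UNIV. \<Sum>t\<in>UNIV. ?J x $ k $ s * D s t * ?J x $ t $ l)"
      by (simp add: sum_negf sum_distrib_left mult.assoc)
    moreover have "(\<Sum>s\<in>UNIV. ?J x $ k $ s * (\<Sum>t\<in>UNIV. A x $ s $ t * d t l))
        = (\<Sum>t\<in>UNIV. (\<Sum>s\<in>UNIV. ?J x $ k $ s * A x $ s $ t) * d t l)"
      unfolding sum_distrib_left sum_distrib_right by (subst sum.swap) (simp add: mult.assoc)
    ultimately show ?thesis
      by (simp add: JA if_distrib[of "\<lambda>u. u * _"] cong: if_cong)
  qed
  have eq0: "wirtinger a (\<lambda>y. \<Sum>t\<in>UNIV. A y $ s $ t * ?J y $ t $ l) x = 0"
    "wirtinger_bar a (\<lambda>y. \<Sum>t\<in>UNIV. A y $ s $ t * ?J y $ t $ l) x = 0" for s l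
    by (rule trans[OF wirtinger_cong(1)[OF S] wirtinger_const(1)], rule AJ, assumption)
       (rule trans[OF wirtinger_cong(2)[OF S] wirtinger_const(2)], rule AJ, assumption)
  have "(\<Sum>t\<in>UNIV. wirtinger a (\<lambda>y. A y $ s $ t) x * ?J x $ t $ l
      + A x $ s $ t * wirtinger a (\<lambda>y. ?J y $ t $ l) x) = 0" for s l
  proof -
    have "0 = (\<Sum>t\<in>UNIV. wirtinger a (\<lambda>y. A y $ s $ t * ?J y $ t $ l) x)"
      unfolding eq0(1)[of s l, symmetric] by (rule wirtinger_sum(1)[OF differentiable_mult[OF A J]])
    also have "\<dots> = (\<Sum>t\<in>UNIV. wirtinger a (\<lambda>y. A y $ s $ t) x * ?J x $ t $ l
        + A x $ s $ t * wirtinger a (\<lambda>y. ?J y $ t $ l) x)"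
      by (intro sum.cong refl wirtinger_mult(1)[OF A J])
    finally show ?thesis by (rule sym)
  qed
  then show "wirtinger a (\<lambda>y. ?J y $ k $ l) x =
      - (\<Sum>s\<in>UNIV. \<Sum>t\<in>UNIV. ?J x $ k $ s * wirtinger a (\<lambda>y. A y $ s $ t) x * ?J x $ t $ l)"
    by (rule solve)
  have "(\<Sum>t\<in>UNIV. wirtinger_bar a (\<lambda>y. A y $ s $ t) x * ?J x $ t $ l
      + A x $ s $ t * wirtinger_bar a (\<lambda>y. ?J y $ t $ l) x) = 0" for s l
  proof -
    have "0 = (\<Sum>t\<in>UNIV. wirtinger_bar a (\<lambda>y. A y $ s $ t * ?J y $ t $ l) x)"
      unfolding eq0(2)[of s l, symmetric] by (rule wirtinger_sum(2)[OF differentiable_mult[OF A J]])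
    also have "\<dots> = (\<Sum>t\<in>UNIV. wirtinger_bar a (\<lambda>y. A y $ s $ t) x * ?J x $ t $ l
        + A x $ s $ t * wirtinger_bar a (\<lambda>y. ?J y $ t $ l) x)"
      by (intro sum.cong refl wirtinger_mult(2)[OF A J])
    finally show ?thesis by (rule sym)
  qed
  then show "wirtinger_bar a (\<lambda>y. ?J y $ k $ l) x =
      - (\<Sum>s\<in>UNIV. \<Sum>t\<in>UNIV. ?J x $ k $ s * wirtinger_bar a (\<lambda>y. A y $ s $ t) x * ?J x $ t $ l)"
    by (rule solve)
qed

text \<open>The first derivative has the shape - J B J with J the inverse and B the derivative of
  \<open>A\<close>. Differentiating the left and the right factor J produces the two quadratic
  terms, with their factors in opposite order.\<close>

lemma wirtinger_wirtinger_bar_matrix_inv: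
  fixes A :: "complex^'m::finite \<Rightarrow> complex^'n::finite^'n"
  assumes S: "open S" "x \<in> S" and nz: "\<And>y. y \<in> S \<Longrightarrow> det (A y) \<noteq> 0"
    and A: "\<And>y i j. y \<in> S \<Longrightarrow> (\<lambda>y. A y $ i $ j) differentiable (at y)"
    and A2: "\<And>i j. wirtinger_bar b (\<lambda>y. A y $ i $ j) differentiable (at x)"
    and id: "A x = mat 1"
  shows "wirtinger_bar b (\<lambda>y. matrix_inv (A y) $ k $ l) differentiable (at x)"
    and "wirtinger a (\<lambda>y. matrix_inv (A y) $ k $ l) x = - wirtinger a (\<lambda>y. A y $ k $ l) x"
    and "wirtinger_bar a (\<lambda>y. matrix_inv (A y) $ k $ l) x = - wirtinger_bar a (\<lambda>y. A y $ k $ l) x"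
    and "wirtinger a (wirtinger_bar b (\<lambda>y. matrix_inv (A y) $ k $ l)) x =
      - wirtinger a (wirtinger_bar b (\<lambda>y. A y $ k $ l)) x
      + (\<Sum>s\<in>UNIV. wirtinger a (\<lambda>y. A y $ k $ s) x * wirtinger_bar b (\<lambda>y. A y $ s $ l) x)
      + (\<Sum>s\<in>UNIV. wirtinger_bar b (\<lambda>y. A y $ k $ s) x * wirtinger a (\<lambda>y. A y $ s $ l) x)"
proof -
  let ?J = "\<lambda>y. matrix_inv (A y)"
  let ?B = "\<lambda>s t. wirtinger_bar b (\<lambda>y. A y $ s $ t)"
  let ?W = "\<lambda>y. - (\<Sum>s\<in>UNIV. \<Sum>t\<in>UNIV. ?J y $ k $ s * ?B s t y * ?J y $ t $ l)"
  note J = differentiable_matrix_inv[OF S nz A[OF S(2)]]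
  have Jid: "?J x $ i $ j = (if i = j then 1 else 0)" for i j
  proof -
    have "?J x = mat 1"
      unfolding id by (metis matrix_inv_inverse(2) det_I matrix_mul_rid zero_neq_one)
    then show ?thesis by (simp add: mat_def)
  qed
  have delta: "(\<Sum>s\<in>UNIV. \<Sum>t\<in>UNIV. (if k = s then 1 else 0) * D s t * (if t = l then 1 else 0)) = D k l"
    for D :: "'n \<Rightarrow> 'n \<Rightarrow> complex" and k l
    by (simp add: if_distrib[of "\<lambda>u. u * _"] if_distrib[of "\<lambda>u. _ * u"] cong: if_cong)
  have e1: "(\<Sum>s\<in>UNIV. \<Sum>t\<in>UNIV. X s * D s t * (if t = l then 1 else 0)) = (\<Sum>s\<in>UNIV. X s * D s l)"
    for X :: "'n \<Rightarrow> complex" and D and l :: 'n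
    by (simp add: if_distrib[of "\<lambda>u. _ * u"] cong: if_cong)
  have e2: "(\<Sum>s\<in>UNIV. \<Sum>t\<in>UNIV. (if k = s then 1 else 0) * D s t * X t) = (\<Sum>t\<in>UNIV. D k t * X t)"
    for X :: "'n \<Rightarrow> complex" and D and k :: 'n
    by (subst sum.swap) (simp add: if_distrib[of "\<lambda>u. u * _"] cong: if_cong)
  \<comment> \<open>This must hold throughout \<open>S\<close>, where the inverse is not the
    identity; J = 1 may be inserted only after the second differentiation.\<close>
  have W: "wirtinger_bar b (\<lambda>y. ?J y $ k $ l) y = ?W y" if "y \<in> S" for y
    using that wirtinger_matrix_inv(2)[OF S(1) that nz A] by simp
  have t: "(\<lambda>y. ?J y $ k $ s * ?B s t y * ?J y $ t $ l) differentiable (at x)" for s t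
    by (intro differentiable_mult J A2)
  then have ts: "(\<lambda>y. \<Sum>t\<in>UNIV. ?J y $ k $ s * ?B s t y * ?J y $ t $ l) differentiable (at x)" for s
    by (intro differentiable_sum) auto
  then have tss: "(\<lambda>y. \<Sum>s\<in>UNIV. \<Sum>t\<in>UNIV. ?J y $ k $ s * ?B s t y * ?J y $ t $ l) differentiable (at x)"
    by (intro differentiable_sum) auto
  then have Wd: "?W differentiable (at x)"
    by (rule differentiable_minus)
  show "wirtinger_bar b (\<lambda>y. ?J y $ k $ l) differentiable (at x)"
    by (rule differentiable_cong_open[OF S _ Wd]) (simp add: W)
  have d1: "wirtinger a (\<lambda>y. ?J y $ k $ l) x = - wirtinger a (\<lambda>y. A y $ k $ l) x" for k l
    using wirtinger_matrix_inv(1)[OF S nz A[OF S(2)], of a k l] unfolding Jid delta .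
  show "wirtinger a (\<lambda>y. ?J y $ k $ l) x = - wirtinger a (\<lambda>y. A y $ k $ l) x"
    by (rule d1)
  show "wirtinger_bar a (\<lambda>y. ?J y $ k $ l) x = - wirtinger_bar a (\<lambda>y. A y $ k $ l) x"
    using wirtinger_matrix_inv(2)[OF S nz A[OF S(2)], of a k l] unfolding Jid delta .
  have prod1: "wirtinger a (\<lambda>y. ?J y $ k $ s * ?B s t y * ?J y $ t $ l) x =
      wirtinger a (\<lambda>y. ?J y $ k $ s * ?B s t y) x * ?J x $ t $ l
      + ?J x $ k $ s * ?B s t x * wirtinger a (\<lambda>y. ?J y $ t $ l) x" for s t
    by (rule wirtinger_mult(1)[OF differentiable_mult[OF J A2] J])
  have prod2: "wirtinger a (\<lambda>y. ?J y $ k $ s * ?B s t y) x =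
      wirtinger a (\<lambda>y. ?J y $ k $ s) x * ?B s t x + ?J x $ k $ s * wirtinger a (?B s t) x" for s t
    by (rule wirtinger_mult(1)[OF J A2])
  have "wirtinger a (wirtinger_bar b (\<lambda>y. ?J y $ k $ l)) x = wirtinger a ?W x"
    by (rule wirtinger_cong[OF S W])
  also have "\<dots> = - (\<Sum>s\<in>UNIV. \<Sum>t\<in>UNIV. wirtinger a (\<lambda>y. ?J y $ k $ s * ?B s t y * ?J y $ t $ l) x)"
    unfolding wirtinger_uminus(1)[OF tss] wirtinger_sum(1)[OF ts] wirtinger_sum(1)[OF t] ..
  also have "\<dots> = - (\<Sum>s\<in>UNIV. \<Sum>t\<in>UNIV.
      (- wirtinger a (\<lambda>y. A y $ k $ s) x) * ?B s t x * (if t = l then 1 else 0)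
      + (if k = s then 1 else 0) * wirtinger a (?B s t) x * (if t = l then 1 else 0)
      - (if k = s then 1 else 0) * ?B s t x * wirtinger a (\<lambda>y. A y $ t $ l) x)"
    unfolding prod1 prod2 d1 Jid by (simp add: algebra_simps)
  also have "\<dots> = - wirtinger a (?B k l) x
      + (\<Sum>s\<in>UNIV. wirtinger a (\<lambda>y. A y $ k $ s) x * ?B s l x)
      + (\<Sum>s\<in>UNIV. ?B k s x * wirtinger a (\<lambda>y. A y $ s $ l) x)"
    unfolding sum.distrib sum_subtractf delta e1 e2 by (simp add: sum_negf)
  finally show "wirtinger a (wirtinger_bar b (\<lambda>y. ?J y $ k $ l)) x =
      - wirtinger a (?B k l) x
      + (\<Sum>s\<in>UNIV. wirtinger a (\<lambda>y. A y $ k $ s) x * ?B s l x)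
      + (\<Sum>s\<in>UNIV. ?B k s x * wirtinger a (\<lambda>y. A y $ s $ l) x)" .
qed

text \<open>The conjugate derivative skips the holomorphic factor \<open>Q\<close>, and the unbarred
  one skips the antiholomorphic factors built from \<open>R\<close>. Of the sixteen terms of the
  double product rule for four factors only nine remain.\<close>

lemma wirtinger_wirtinger_bar_product:
  assumes S: "open S" "x \<in> S"
    and P: "\<And>y. y \<in> S \<Longrightarrow> P differentiable (at y)" "wirtinger_bar b P differentiable (at x)"
    and T: "\<And>y. y \<in> S \<Longrightarrow> T differentiable (at y)" "wirtinger_bar b T differentiable (at x)"
    and Q: "\<And>y. y \<in> S \<Longrightarrow> holo_at Q y" and R: "\<And>y. y \<in> S \<Longrightarrow> holo_at R y"
  shows "(\<lambda>y. P y * (Q y * cnj (R y) * T y)) differentiable (at x)"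
    and "wirtinger_bar b (\<lambda>y. P y * (Q y * cnj (R y) * T y)) differentiable (at x)"
    and "wirtinger a (wirtinger_bar b (\<lambda>y. P y * (Q y * cnj (R y) * T y))) x =
      wirtinger a (wirtinger_bar b P) x * (Q x * cnj (R x) * T x)
      + wirtinger_bar b P x * (wirtinger a Q x * cnj (R x) * T x)
      + wirtinger_bar b P x * (Q x * cnj (R x) * wirtinger a T x)
      + wirtinger a P x * (Q x * cnj (wirtinger b R x) * T x)
      + P x * (wirtinger a Q x * cnj (wirtinger b R x) * T x)
      + P x * (Q x * cnj (wirtinger b R x) * wirtinger a T x)
      + wirtinger a P x * (Q x * cnj (R x) * wirtinger_bar b T x)
      + P x * (wirtinger a Q x * cnj (R x) * wirtinger_bar b T x)
      + P x * (Q x * cnj (R x) * wirtinger a (wirtinger_bar b T) x)"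
proof -
  have Qd: "Q differentiable (at y)" "R differentiable (at y)"
    "wirtinger_bar c Q y = 0" "wirtinger_bar c R y = 0" if "y \<in> S" for y c
    using Q[OF that] R[OF that] by (auto simp: holo_at_def)
  \<comment> \<open>The first differentiation turns \<open>cnj (R y)\<close> into
    \<open>cnj (wirtinger b R y)\<close>; that this factor is differentiable and antiholomorphic at
    \<open>x\<close> rests on the Cauchy integral.\<close>
  have Rb: "wirtinger b R differentiable (at x)" "wirtinger_bar a (wirtinger b R) x = 0"
    using holo_at_wirtinger[OF S R] by (auto simp: holo_at_def)
  let ?W = "\<lambda>y. wirtinger_bar b P y * (Q y * cnj (R y) * T y)
      + P y * (Q y * cnj (wirtinger b R y) * T y) + P y * (Q y * cnj (R y) * wirtinger_bar b T y)"
  note dr = differentiable_mult differentiable_cnj differentiable_add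
  show "(\<lambda>y. P y * (Q y * cnj (R y) * T y)) differentiable (at x)"
    using S by (intro dr P T Qd)
  have W: "wirtinger_bar b (\<lambda>y. P y * (Q y * cnj (R y) * T y)) y = ?W y" if "y \<in> S" for y
    by (simp add: wirtinger_mult wirtinger_cnj dr P T Qd that algebra_simps)
  have Wd: "?W differentiable (at x)"
    using S by (intro dr P T Qd Rb)
  show "wirtinger_bar b (\<lambda>y. P y * (Q y * cnj (R y) * T y)) differentiable (at x)"
    by (rule differentiable_cong_open[OF S _ Wd]) (simp add: W)
  have p: "wirtinger a (\<lambda>y. p y * (Q y * r y * t y)) x =
      wirtinger a p x * (Q x * r x * t x) + p x * (wirtinger a Q x * r x * t x)
      + p x * (Q x * wirtinger a r x * t x) + p x * (Q x * r x * wirtinger a t x)"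
    if "p differentiable (at x)" "r differentiable (at x)" "t differentiable (at x)" for p r t
    using that Qd(1)[OF S(2)] by (simp add: wirtinger_mult differentiable_mult algebra_simps)
  note R' = differentiable_cnj[OF Qd(2)[OF S(2)]]
  note P' = P(1)[OF S(2)] and T' = T(1)[OF S(2)] and Rb' = differentiable_cnj[OF Rb(1)]
  have r: "wirtinger a (\<lambda>y. cnj (R y)) x = 0" "wirtinger a (\<lambda>y. cnj (wirtinger b R y)) x = 0"
    by (simp_all add: wirtinger_cnj Qd S Rb)
  have "wirtinger a (wirtinger_bar b (\<lambda>y. P y * (Q y * cnj (R y) * T y))) x = wirtinger a ?W x"
    by (rule wirtinger_cong[OF S W])
  also have "\<dots> = wirtinger a (\<lambda>y. wirtinger_bar b P y * (Q y * cnj (R y) * T y)) x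
      + wirtinger a (\<lambda>y. P y * (Q y * cnj (wirtinger b R y) * T y)) x
      + wirtinger a (\<lambda>y. P y * (Q y * cnj (R y) * wirtinger_bar b T y)) x"
    by (simp only: wirtinger_add dr P' P(2) T' T(2) R' Rb' Qd(1)[OF S(2)])
  also have "\<dots> =
      wirtinger a (wirtinger_bar b P) x * (Q x * cnj (R x) * T x)
      + wirtinger_bar b P x * (wirtinger a Q x * cnj (R x) * T x)
      + wirtinger_bar b P x * (Q x * cnj (R x) * wirtinger a T x)
      + wirtinger a P x * (Q x * cnj (wirtinger b R x) * T x)
      + P x * (wirtinger a Q x * cnj (wirtinger b R x) * T x)
      + P x * (Q x * cnj (wirtinger b R x) * wirtinger a T x)
      + wirtinger a P x * (Q x * cnj (R x) * wirtinger_bar b T x)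
      + P x * (wirtinger a Q x * cnj (R x) * wirtinger_bar b T x)
      + P x * (Q x * cnj (R x) * wirtinger a (wirtinger_bar b T) x)"
    unfolding p[OF P(2) R' T'] p[OF P' Rb' T'] p[OF P' R' T(2)] r by (simp add: algebra_simps)
  finally show "wirtinger a (wirtinger_bar b (\<lambda>y. P y * (Q y * cnj (R y) * T y))) x =
      wirtinger a (wirtinger_bar b P) x * (Q x * cnj (R x) * T x)
      + wirtinger_bar b P x * (wirtinger a Q x * cnj (R x) * T x)
      + wirtinger_bar b P x * (Q x * cnj (R x) * wirtinger a T x)
      + wirtinger a P x * (Q x * cnj (wirtinger b R x) * T x)
      + P x * (wirtinger a Q x * cnj (wirtinger b R x) * T x)
      + P x * (Q x * cnj (wirtinger b R x) * wirtinger a T x)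
      + wirtinger a P x * (Q x * cnj (R x) * wirtinger_bar b T x)
      + P x * (wirtinger a Q x * cnj (R x) * wirtinger_bar b T x)
      + P x * (Q x * cnj (R x) * wirtinger a (wirtinger_bar b T) x)" .
qed

section \<open>The Bochner identity in coordinates\<close>

text \<open>\<open>q\<close> are the components of the section; the suffixes \<open>a\<close> and \<open>b\<close> mark \<open>\<partial>\<^sub>a\<close> and \<open>\<partial>\<^sub>b\<close> (not the conjugate
  derivative), and \<open>2\<close> marks the mixed second derivative, of the section and of the two metrics \<open>G\<close>, \<open>H\<close>.\<close>

lemma bochner_algebra:
  fixes q qa qb :: "'m::finite \<Rightarrow> 'n::finite \<Rightarrow> complex" and Ga Gb G2 :: "'m \<Rightarrow> 'm \<Rightarrow> complex"
    and Ha Hb H2 :: "'n \<Rightarrow> 'n \<Rightarrow> complex"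
  defines "\<And>k i. Na k i \<equiv> qa k i - (\<Sum>j\<in>UNIV. q j i * Ga k j) + (\<Sum>j\<in>UNIV. q k j * Ha j i)"
    and "\<And>k i. Nb k i \<equiv> qb k i - (\<Sum>j\<in>UNIV. q j i * Gb k j) + (\<Sum>j\<in>UNIV. q k j * Hb j i)"
  shows "(\<Sum>\<alpha>\<in>UNIV. \<Sum>\<beta>\<in>UNIV. \<Sum>i\<in>UNIV. \<Sum>j\<in>UNIV.
      (- G2 \<beta> \<alpha> + (\<Sum>s\<in>UNIV. Ga \<beta> s * cnj (Gb \<alpha> s)) + (\<Sum>s\<in>UNIV. cnj (Gb s \<beta>) * Ga s \<alpha>))
          * (q \<alpha> i * cnj (q \<beta> j) * (if i = j then 1 else 0))
      + (- cnj (Gb \<alpha> \<beta>)) * (qa \<alpha> i * cnj (q \<beta> j) * (if i = j then 1 else 0))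
      + (- cnj (Gb \<alpha> \<beta>)) * (q \<alpha> i * cnj (q \<beta> j) * Ha i j)
      + (- Ga \<beta> \<alpha>) * (q \<alpha> i * cnj (qb \<beta> j) * (if i = j then 1 else 0))
      + (if \<alpha> = \<beta> then 1 else 0) * (qa \<alpha> i * cnj (qb \<beta> j) * (if i = j then 1 else 0))
      + (if \<alpha> = \<beta> then 1 else 0) * (q \<alpha> i * cnj (qb \<beta> j) * Ha i j)
      + (- Ga \<beta> \<alpha>) * (q \<alpha> i * cnj (q \<beta> j) * cnj (Hb j i))
      + (if \<alpha> = \<beta> then 1 else 0) * (qa \<alpha> i * cnj (q \<beta> j) * cnj (Hb j i))
      + (if \<alpha> = \<beta> then 1 else 0) * (q \<alpha> i * cnj (q \<beta> j) * H2 i j))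
    = (\<Sum>\<alpha>\<in>UNIV. \<Sum>\<beta>\<in>UNIV. \<Sum>i\<in>UNIV.
        (- G2 \<beta> \<alpha> + (\<Sum>s\<in>UNIV. Ga \<beta> s * cnj (Gb \<alpha> s))) * (q \<alpha> i * cnj (q \<beta> i)))
      - (\<Sum>\<alpha>\<in>UNIV. \<Sum>i\<in>UNIV. \<Sum>j\<in>UNIV.
          (- H2 i j + (\<Sum>u\<in>UNIV. Ha i u * cnj (Hb j u))) * (q \<alpha> i * cnj (q \<alpha> j)))
      + (\<Sum>k\<in>UNIV. \<Sum>i\<in>UNIV. Na k i * cnj (Nb k i))"
    (is "?L = ?R")
proof -
  \<comment> \<open>\<open>?Y\<close> is the contribution of the dual connection to the covariant
    derivative, \<open>?Z\<close> that of the pulled-back connection. The nine products obtained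
    from \<open>qa - ?Y + ?Z\<close> and the conjugate of its \<open>b\<close>-version match the
    nine terms on the left one to one, except that \<open>YY\<close> and \<open>ZZ\<close> interact
    with the curvatures.\<close>
  let ?Y = "\<lambda>G k i. \<Sum>j\<in>UNIV. q j i * G k j" and ?Z = "\<lambda>H k i. \<Sum>j\<in>UNIV. q k j * H j i"
  \<comment> \<open>One of the two quadratic terms from the inverse of G, contracted over the row
    index of both derivatives. The other, contracted over the column index, stays in the curvature
    of G.\<close>
  have YY: "(\<Sum>k\<in>UNIV. \<Sum>i\<in>UNIV. ?Y Ga k i * cnj (?Y Gb k i))
      = (\<Sum>\<alpha>\<in>UNIV. \<Sum>\<beta>\<in>UNIV. \<Sum>i\<in>UNIV. (\<Sum>s\<in>UNIV. cnj (Gb s \<beta>) * Ga s \<alpha>) * (q \<alpha> i * cnj (q \<beta> i)))"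
  proof -
    let ?F = "\<lambda>k i j l. cnj (Gb k l) * Ga k j * (q j i * cnj (q l i))"
    have "(\<Sum>k\<in>UNIV. \<Sum>i\<in>UNIV. ?Y Ga k i * cnj (?Y Gb k i))
        = (\<Sum>k\<in>UNIV. \<Sum>i\<in>UNIV. \<Sum>j\<in>UNIV. \<Sum>l\<in>UNIV. ?F k i j l)"
      by (simp add: sum_product mult_ac)
    also have "\<dots> = (\<Sum>k\<in>UNIV. \<Sum>j\<in>UNIV. \<Sum>i\<in>UNIV. \<Sum>l\<in>UNIV. ?F k i j l)"
      by (rule sum.cong[OF refl sum.swap])
    also have "\<dots> = (\<Sum>j\<in>UNIV. \<Sum>k\<in>UNIV. \<Sum>i\<in>UNIV. \<Sum>l\<in>UNIV. ?F k i j l)"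
      by (rule sum.swap)
    also have "\<dots> = (\<Sum>j\<in>UNIV. \<Sum>k\<in>UNIV. \<Sum>l\<in>UNIV. \<Sum>i\<in>UNIV. ?F k i j l)"
      by (rule sum.cong[OF refl sum.cong[OF refl sum.swap]])
    also have "\<dots> = (\<Sum>j\<in>UNIV. \<Sum>l\<in>UNIV. \<Sum>k\<in>UNIV. \<Sum>i\<in>UNIV. ?F k i j l)"
      by (rule sum.cong[OF refl sum.swap])
    also have "\<dots> = (\<Sum>j\<in>UNIV. \<Sum>l\<in>UNIV. \<Sum>i\<in>UNIV. \<Sum>k\<in>UNIV. ?F k i j l)"
      by (rule sum.cong[OF refl sum.cong[OF refl sum.swap]])
    finally show ?thesis by (simp add: sum_distrib_right)
  qed
  have XY: "(\<Sum>k\<in>UNIV. \<Sum>i\<in>UNIV. qa k i * cnj (?Y Gb k i))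
      = (\<Sum>\<alpha>\<in>UNIV. \<Sum>\<beta>\<in>UNIV. \<Sum>i\<in>UNIV. cnj (Gb \<alpha> \<beta>) * (qa \<alpha> i * cnj (q \<beta> i)))"
  proof -
    have "(\<Sum>k\<in>UNIV. \<Sum>i\<in>UNIV. qa k i * cnj (?Y Gb k i))
      = (\<Sum>k\<in>UNIV. \<Sum>i\<in>UNIV. \<Sum>l\<in>UNIV. cnj (Gb k l) * (qa k i * cnj (q l i)))"
      by (simp add: sum_distrib_left mult_ac)
    also have "\<dots> = (\<Sum>k\<in>UNIV. \<Sum>l\<in>UNIV. \<Sum>i\<in>UNIV. cnj (Gb k l) * (qa k i * cnj (q l i)))"
      by (rule sum.cong[OF refl sum.swap])
    finally show ?thesis .
  qed
  have YX: "(\<Sum>k\<in>UNIV. \<Sum>i\<in>UNIV. ?Y Ga k i * cnj (qb k i))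
      = (\<Sum>\<alpha>\<in>UNIV. \<Sum>\<beta>\<in>UNIV. \<Sum>i\<in>UNIV. Ga \<beta> \<alpha> * (q \<alpha> i * cnj (qb \<beta> i)))"
  proof -
    have "(\<Sum>k\<in>UNIV. \<Sum>i\<in>UNIV. ?Y Ga k i * cnj (qb k i))
      = (\<Sum>k\<in>UNIV. \<Sum>i\<in>UNIV. \<Sum>j\<in>UNIV. Ga k j * (q j i * cnj (qb k i)))"
      by (simp add: sum_distrib_left sum_distrib_right mult_ac)
    also have "\<dots> = (\<Sum>k\<in>UNIV. \<Sum>j\<in>UNIV. \<Sum>i\<in>UNIV. Ga k j * (q j i * cnj (qb k i)))"
      by (rule sum.cong[OF refl sum.swap])
    also have "\<dots> = (\<Sum>j\<in>UNIV. \<Sum>k\<in>UNIV. \<Sum>i\<in>UNIV. Ga k j * (q j i * cnj (qb k i)))"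
      by (rule sum.swap)
    finally show ?thesis .
  qed
  have XZ: "(\<Sum>k\<in>UNIV. \<Sum>i\<in>UNIV. qa k i * cnj (?Z Hb k i))
      = (\<Sum>\<alpha>\<in>UNIV. \<Sum>i\<in>UNIV. \<Sum>j\<in>UNIV. qa \<alpha> i * cnj (q \<alpha> j) * cnj (Hb j i))"
    by (simp add: sum_distrib_left mult_ac)
  have ZX: "(\<Sum>k\<in>UNIV. \<Sum>i\<in>UNIV. ?Z Ha k i * cnj (qb k i))
      = (\<Sum>\<alpha>\<in>UNIV. \<Sum>i\<in>UNIV. \<Sum>j\<in>UNIV. q \<alpha> i * cnj (qb \<alpha> j) * Ha i j)"
  proof -
    have "(\<Sum>k\<in>UNIV. \<Sum>i\<in>UNIV. ?Z Ha k i * cnj (qb k i))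
      = (\<Sum>k\<in>UNIV. \<Sum>i\<in>UNIV. \<Sum>j\<in>UNIV. q k j * cnj (qb k i) * Ha j i)"
      by (simp add: sum_distrib_left sum_distrib_right mult_ac)
    also have "\<dots> = (\<Sum>k\<in>UNIV. \<Sum>j\<in>UNIV. \<Sum>i\<in>UNIV. q k j * cnj (qb k i) * Ha j i)"
      by (rule sum.cong[OF refl sum.swap])
    finally show ?thesis .
  qed
  have YZ: "(\<Sum>k\<in>UNIV. \<Sum>i\<in>UNIV. ?Y Ga k i * cnj (?Z Hb k i))
      = (\<Sum>\<alpha>\<in>UNIV. \<Sum>\<beta>\<in>UNIV. \<Sum>i\<in>UNIV. \<Sum>j\<in>UNIV. Ga \<beta> \<alpha> * (q \<alpha> i * cnj (q \<beta> j) * cnj (Hb j i)))"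
  proof -
    let ?F = "\<lambda>k i j l. Ga k j * (q j i * cnj (q k l) * cnj (Hb l i))"
    have "(\<Sum>k\<in>UNIV. \<Sum>i\<in>UNIV. ?Y Ga k i * cnj (?Z Hb k i))
        = (\<Sum>k\<in>UNIV. \<Sum>i\<in>UNIV. \<Sum>j\<in>UNIV. \<Sum>l\<in>UNIV. ?F k i j l)"
      by (simp add: sum_product mult_ac)
    also have "\<dots> = (\<Sum>k\<in>UNIV. \<Sum>j\<in>UNIV. \<Sum>i\<in>UNIV. \<Sum>l\<in>UNIV. ?F k i j l)"
      by (rule sum.cong[OF refl sum.swap])
    also have "\<dots> = (\<Sum>j\<in>UNIV. \<Sum>k\<in>UNIV. \<Sum>i\<in>UNIV. \<Sum>l\<in>UNIV. ?F k i j l)"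
      by (rule sum.swap)
    finally show ?thesis .
  qed
  have ZY: "(\<Sum>k\<in>UNIV. \<Sum>i\<in>UNIV. ?Z Ha k i * cnj (?Y Gb k i))
      = (\<Sum>\<alpha>\<in>UNIV. \<Sum>\<beta>\<in>UNIV. \<Sum>i\<in>UNIV. \<Sum>j\<in>UNIV. cnj (Gb \<alpha> \<beta>) * (q \<alpha> i * cnj (q \<beta> j) * Ha i j))"
  proof -
    let ?F = "\<lambda>k i j l. cnj (Gb k l) * (q k j * cnj (q l i) * Ha j i)"
    have "(\<Sum>k\<in>UNIV. \<Sum>i\<in>UNIV. ?Z Ha k i * cnj (?Y Gb k i))
        = (\<Sum>k\<in>UNIV. \<Sum>i\<in>UNIV. \<Sum>j\<in>UNIV. \<Sum>l\<in>UNIV. ?F k i j l)"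
      by (simp add: sum_product mult_ac)
    also have "\<dots> = (\<Sum>k\<in>UNIV. \<Sum>j\<in>UNIV. \<Sum>i\<in>UNIV. \<Sum>l\<in>UNIV. ?F k i j l)"
      by (rule sum.cong[OF refl sum.swap])
    also have "\<dots> = (\<Sum>k\<in>UNIV. \<Sum>j\<in>UNIV. \<Sum>l\<in>UNIV. \<Sum>i\<in>UNIV. ?F k i j l)"
      by (rule sum.cong[OF refl sum.cong[OF refl sum.swap]])
    also have "\<dots> = (\<Sum>k\<in>UNIV. \<Sum>l\<in>UNIV. \<Sum>j\<in>UNIV. \<Sum>i\<in>UNIV. ?F k i j l)"
      by (rule sum.cong[OF refl sum.swap])
    finally show ?thesis .
  qed
  \<comment> \<open>This is the quadratic part of the curvature of H. That curvature enters with a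
    minus sign, so the two cancel and only the second derivative \<open>H2\<close> is left, as on
    the left-hand side.\<close>
  have ZZ: "(\<Sum>k\<in>UNIV. \<Sum>i\<in>UNIV. ?Z Ha k i * cnj (?Z Hb k i))
      = (\<Sum>\<alpha>\<in>UNIV. \<Sum>i\<in>UNIV. \<Sum>j\<in>UNIV. (\<Sum>u\<in>UNIV. Ha i u * cnj (Hb j u)) * (q \<alpha> i * cnj (q \<alpha> j)))"
  proof -
    let ?F = "\<lambda>k i j l. Ha j i * cnj (Hb l i) * (q k j * cnj (q k l))"
    have "(\<Sum>k\<in>UNIV. \<Sum>i\<in>UNIV. ?Z Ha k i * cnj (?Z Hb k i))
        = (\<Sum>k\<in>UNIV. \<Sum>i\<in>UNIV. \<Sum>j\<in>UNIV. \<Sum>l\<in>UNIV. ?F k i j l)"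
      by (simp add: sum_product mult_ac)
    also have "\<dots> = (\<Sum>k\<in>UNIV. \<Sum>j\<in>UNIV. \<Sum>i\<in>UNIV. \<Sum>l\<in>UNIV. ?F k i j l)"
      by (rule sum.cong[OF refl sum.swap])
    also have "\<dots> = (\<Sum>k\<in>UNIV. \<Sum>j\<in>UNIV. \<Sum>l\<in>UNIV. \<Sum>i\<in>UNIV. ?F k i j l)"
      by (rule sum.cong[OF refl sum.cong[OF refl sum.swap]])
    finally show ?thesis by (simp add: sum_distrib_right)
  qed
  have N: "Na k i * cnj (Nb k i) = qa k i * cnj (qb k i)
      - qa k i * cnj (?Y Gb k i) + qa k i * cnj (?Z Hb k i)
      - ?Y Ga k i * cnj (qb k i) + ?Y Ga k i * cnj (?Y Gb k i) - ?Y Ga k i * cnj (?Z Hb k i)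
      + ?Z Ha k i * cnj (qb k i) - ?Z Ha k i * cnj (?Y Gb k i) + ?Z Ha k i * cnj (?Z Hb k i)" for k i
    unfolding assms complex_cnj_add complex_cnj_diff by (simp only: algebra_simps)
  have d1: "(\<Sum>j\<in>UNIV. c * (t * u j * (if i = j then 1 else 0))) = c * (t * u i)"
    for c t :: complex and u and i :: 'n
    by (simp add: if_distrib cong: if_cong)
  have d2: "(\<Sum>\<beta>\<in>UNIV. \<Sum>i\<in>UNIV. \<Sum>j\<in>UNIV. (if \<alpha> = \<beta> then 1 else 0) * E \<beta> i j) = (\<Sum>i\<in>UNIV. \<Sum>j\<in>UNIV. E \<alpha> i j)"
    for \<alpha> :: 'm and E :: "'m \<Rightarrow> 'n \<Rightarrow> 'n \<Rightarrow> complex"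
  proof -
    have "(\<Sum>i\<in>UNIV. \<Sum>j\<in>UNIV. (if \<alpha> = \<beta> then 1 else 0) * E \<beta> i j) = (if \<alpha> = \<beta> then \<Sum>i\<in>UNIV. \<Sum>j\<in>UNIV. E \<beta> i j else 0)" for \<beta>
      by simp
    then show ?thesis by simp
  qed
  have d4: "(\<Sum>\<beta>\<in>UNIV. \<Sum>i\<in>UNIV. (if \<alpha> = \<beta> then 1 else 0) * E \<beta> i) = (\<Sum>i\<in>UNIV. E \<alpha> i)"
    for \<alpha> :: 'm and E :: "'m \<Rightarrow> 'n \<Rightarrow> complex"
    by (subst sum.swap) (simp add: if_distrib[of "\<lambda>u. u * _"] cong: if_cong)
  have "?L = (\<Sum>\<alpha>\<in>UNIV. \<Sum>\<beta>\<in>UNIV. \<Sum>i\<in>UNIV.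
        (- G2 \<beta> \<alpha> + (\<Sum>s\<in>UNIV. Ga \<beta> s * cnj (Gb \<alpha> s)) + (\<Sum>s\<in>UNIV. cnj (Gb s \<beta>) * Ga s \<alpha>)) * (q \<alpha> i * cnj (q \<beta> i)))
      + (\<Sum>\<alpha>\<in>UNIV. \<Sum>\<beta>\<in>UNIV. \<Sum>i\<in>UNIV. - cnj (Gb \<alpha> \<beta>) * (qa \<alpha> i * cnj (q \<beta> i)))
      + (\<Sum>\<alpha>\<in>UNIV. \<Sum>\<beta>\<in>UNIV. \<Sum>i\<in>UNIV. \<Sum>j\<in>UNIV. - cnj (Gb \<alpha> \<beta>) * (q \<alpha> i * cnj (q \<beta> j) * Ha i j))
      + (\<Sum>\<alpha>\<in>UNIV. \<Sum>\<beta>\<in>UNIV. \<Sum>i\<in>UNIV. - Ga \<beta> \<alpha> * (q \<alpha> i * cnj (qb \<beta> i)))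
      + (\<Sum>\<alpha>\<in>UNIV. \<Sum>i\<in>UNIV. qa \<alpha> i * cnj (qb \<alpha> i))
      + (\<Sum>\<alpha>\<in>UNIV. \<Sum>i\<in>UNIV. \<Sum>j\<in>UNIV. q \<alpha> i * cnj (qb \<alpha> j) * Ha i j)
      + (\<Sum>\<alpha>\<in>UNIV. \<Sum>\<beta>\<in>UNIV. \<Sum>i\<in>UNIV. \<Sum>j\<in>UNIV. - Ga \<beta> \<alpha> * (q \<alpha> i * cnj (q \<beta> j) * cnj (Hb j i)))
      + (\<Sum>\<alpha>\<in>UNIV. \<Sum>i\<in>UNIV. \<Sum>j\<in>UNIV. qa \<alpha> i * cnj (q \<alpha> j) * cnj (Hb j i))
      + (\<Sum>\<alpha>\<in>UNIV. \<Sum>i\<in>UNIV. \<Sum>j\<in>UNIV. q \<alpha> i * cnj (q \<alpha> j) * H2 i j)"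
    unfolding sum.distrib d2 d1 d4 ..
  also have "\<dots> = ?R"
    unfolding N sum.distrib sum_subtractf YY XY YX XZ ZX YZ ZY ZZ distrib_right mult_minus_left sum_negf
    by (simp add: mult_ac)
  finally show ?thesis .
qed

section \<open>Mixed second derivatives of sums, compositions and squared norms\<close>

lemma wirtinger_wirtinger_bar_sum:
  assumes S: "open S" "x \<in> S" and I: "finite I"
    and F: "\<And>i y. i \<in> I \<Longrightarrow> y \<in> S \<Longrightarrow> F i differentiable (at y)"
    and F2: "\<And>i. i \<in> I \<Longrightarrow> wirtinger_bar b (F i) differentiable (at x)"
  shows "wirtinger_bar b (\<lambda>y. \<Sum>i\<in>I. F i y) differentiable (at x)"
    and "wirtinger a (wirtinger_bar b (\<lambda>y. \<Sum>i\<in>I. F i y)) x = (\<Sum>i\<in>I. wirtinger a (wirtinger_bar b (F i)) x)"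
proof -
  have W: "wirtinger_bar b (\<lambda>y. \<Sum>i\<in>I. F i y) y = (\<Sum>i\<in>I. wirtinger_bar b (F i) y)" if "y \<in> S" for y
    using F that by (intro wirtinger_sum(2)) auto
  have "(\<lambda>y. \<Sum>i\<in>I. wirtinger_bar b (F i) y) differentiable (at x)"
    using I F2 by (intro differentiable_sum) auto
  then show "wirtinger_bar b (\<lambda>y. \<Sum>i\<in>I. F i y) differentiable (at x)"
    by (rule differentiable_cong_open[OF S, rotated]) (simp only: W)
  show "wirtinger a (wirtinger_bar b (\<lambda>y. \<Sum>i\<in>I. F i y)) x = (\<Sum>i\<in>I. wirtinger a (wirtinger_bar b (F i)) x)"
    by (rule trans[OF wirtinger_cong(1)[OF S] wirtinger_sum(1)[OF F2]]) (simp_all only: W)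
qed

text \<open>The unbarred derivative annihilates the factors
  \<open>cnj (wirtinger b (\<lambda>y. \<phi> y $ t) y)\<close>, so no second derivatives of \<phi>
  appear. This is why the curvature of the target is simply pulled back.\<close>

lemma wirtinger_wirtinger_bar_compose:
  fixes \<phi> :: "complex^'m::finite \<Rightarrow> complex^'n::finite"
  assumes S: "open S" "x \<in> S" and \<phi>: "\<And>y i. y \<in> S \<Longrightarrow> holo_at (\<lambda>y. \<phi> y $ i) y"
    and H: "\<And>y. y \<in> S \<Longrightarrow> H differentiable (at (\<phi> y))"
    and H2: "\<And>t. wirtinger_bar t H differentiable (at (\<phi> x))"
  shows "wirtinger_bar b (\<lambda>y. H (\<phi> y)) differentiable (at x)"
    and "wirtinger a (wirtinger_bar b (\<lambda>y. H (\<phi> y))) x =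
      (\<Sum>s\<in>UNIV. \<Sum>t\<in>UNIV. wirtinger a (\<lambda>y. \<phi> y $ s) x * cnj (wirtinger b (\<lambda>y. \<phi> y $ t) x) *
        wirtinger s (wirtinger_bar t H) (\<phi> x))"
proof -
  let ?p = "\<lambda>t y. cnj (wirtinger b (\<lambda>y. \<phi> y $ t) y)"
  let ?W = "\<lambda>y. \<Sum>t\<in>UNIV. ?p t y * wirtinger_bar t H (\<phi> y)"
  have W: "wirtinger_bar b (\<lambda>y. H (\<phi> y)) y = ?W y" if "y \<in> S" for y
    by (rule wirtinger_chain(3)[OF \<phi>[OF that] H[OF that]])
  have h: "holo_at (wirtinger b (\<lambda>y. \<phi> y $ t)) x" for t
    by (rule holo_at_wirtinger[OF S \<phi>])
  have p: "?p t differentiable (at x)" "wirtinger a (?p t) x = 0" for t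
    using h[of t] by (auto simp: holo_at_def wirtinger_cnj intro: differentiable_cnj)
  note c = wirtinger_chain(1,2)[OF \<phi>[OF S(2)] H2]
  have d: "(\<lambda>y. ?p t y * wirtinger_bar t H (\<phi> y)) differentiable (at x)" for t
    by (intro differentiable_mult p c)
  then have "?W differentiable (at x)"
    by (intro differentiable_sum) auto
  then show "wirtinger_bar b (\<lambda>y. H (\<phi> y)) differentiable (at x)"
    by (rule differentiable_cong_open[OF S, rotated]) (simp only: W)
  have "wirtinger a (wirtinger_bar b (\<lambda>y. H (\<phi> y))) x = wirtinger a ?W x"
    by (rule wirtinger_cong[OF S W])
  also have "\<dots> = (\<Sum>t\<in>UNIV. wirtinger a (\<lambda>y. ?p t y * wirtinger_bar t H (\<phi> y)) x)"
    by (rule wirtinger_sum(1)[OF d])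
  also have "\<dots> = (\<Sum>t\<in>UNIV. ?p t x * wirtinger a (\<lambda>y. wirtinger_bar t H (\<phi> y)) x)"
    by (intro sum.cong refl, subst wirtinger_mult(1)[OF p(1) c(1)]) (simp add: p)
  also have "\<dots> = (\<Sum>t\<in>UNIV. \<Sum>s\<in>UNIV. wirtinger a (\<lambda>y. \<phi> y $ s) x * ?p t x *
        wirtinger s (wirtinger_bar t H) (\<phi> x))"
    by (simp add: c(2) sum_distrib_left mult_ac)
  also have "\<dots> = (\<Sum>s\<in>UNIV. \<Sum>t\<in>UNIV. wirtinger a (\<lambda>y. \<phi> y $ s) x * ?p t x *
        wirtinger s (wirtinger_bar t H) (\<phi> x))"
    by (rule sum.swap)
  finally show "wirtinger a (wirtinger_bar b (\<lambda>y. H (\<phi> y))) x = \<dots>" .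
qed

text \<open>Trades barred derivatives of a Hermitian matrix for conjugates of unbarred derivatives
  of the transposed entries, the form in which they occur in the conjugate of \<nabla>_b V.\<close>

lemma wirtinger_bar_hermitian:
  assumes S: "open S" "x \<in> S" and h: "\<And>y. y \<in> S \<Longrightarrow> F y = cnj (G y)" and G: "G differentiable (at x)"
  shows "wirtinger_bar b F x = cnj (wirtinger b G x)"
  by (rule trans[OF wirtinger_cong(2)[OF S] wirtinger_cnj(2)[OF G]]) (simp only: h)

text \<open>\<open>G\<close> stands for the source metric in a chart and \<open>T\<close> for the
  target metric composed with the map. As both are the identity at \<open>x\<close>, the connection
  coefficients there are plain first derivatives of the metrics, so \<open>N c\<close> is the
  covariant derivative of the section. The order \<open>$ l $ k\<close> follows the transposed
  convention of \<open>metric_inv\<close>.\<close>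

lemma wirtinger_wirtinger_bar_norm_holomorphic_section:
  fixes G :: "complex^'m::finite \<Rightarrow> complex^'m^'m" and T :: "complex^'m \<Rightarrow> complex^'n::finite^'n"
    and Q :: "'m \<Rightarrow> 'n \<Rightarrow> complex^'m \<Rightarrow> complex" and x :: "complex^'m"
  defines "\<And>c k i. N c k i \<equiv> wirtinger c (Q k i) x - (\<Sum>j\<in>UNIV. Q j i x * wirtinger c (\<lambda>y. G y $ k $ j) x)
      + (\<Sum>j\<in>UNIV. Q k j x * wirtinger c (\<lambda>y. T y $ j $ i) x)"
  assumes S: "open S" "x \<in> S"
    and G: "\<And>y k l. y \<in> S \<Longrightarrow> (\<lambda>y. G y $ k $ l) differentiable (at y)"
      "\<And>k l. wirtinger_bar b (\<lambda>y. G y $ k $ l) differentiable (at x)"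
      "\<And>y. y \<in> S \<Longrightarrow> det (G y) \<noteq> 0" "\<And>y k l. y \<in> S \<Longrightarrow> G y $ l $ k = cnj (G y $ k $ l)"
      "G x = mat 1"
    and T: "\<And>y i j. y \<in> S \<Longrightarrow> (\<lambda>y. T y $ i $ j) differentiable (at y)"
      "\<And>i j. wirtinger_bar b (\<lambda>y. T y $ i $ j) differentiable (at x)"
      "\<And>y i j. y \<in> S \<Longrightarrow> T y $ j $ i = cnj (T y $ i $ j)"
      "T x = mat 1"
    and Q: "\<And>y k i. y \<in> S \<Longrightarrow> holo_at (Q k i) y"
  shows "wirtinger a (wirtinger_bar b (\<lambda>y. \<Sum>k\<in>UNIV. \<Sum>l\<in>UNIV. \<Sum>i\<in>UNIV. \<Sum>j\<in>UNIV.
        matrix_inv (G y) $ l $ k * (Q k i y * cnj (Q l j y) * T y $ i $ j))) x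
    = (\<Sum>k\<in>UNIV. \<Sum>l\<in>UNIV. \<Sum>i\<in>UNIV.
        (- wirtinger a (wirtinger_bar b (\<lambda>y. G y $ l $ k)) x
         + (\<Sum>s\<in>UNIV. wirtinger a (\<lambda>y. G y $ l $ s) x * wirtinger_bar b (\<lambda>y. G y $ s $ k) x))
        * (Q k i x * cnj (Q l i x)))
      - (\<Sum>k\<in>UNIV. \<Sum>i\<in>UNIV. \<Sum>j\<in>UNIV.
        (- wirtinger a (wirtinger_bar b (\<lambda>y. T y $ i $ j)) x
         + (\<Sum>u\<in>UNIV. wirtinger a (\<lambda>y. T y $ i $ u) x * wirtinger_bar b (\<lambda>y. T y $ u $ j) x))
        * (Q k i x * cnj (Q k j x)))
      + (\<Sum>k\<in>UNIV. \<Sum>i\<in>UNIV. N a k i * cnj (N b k i))"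
proof -
  let ?J = "\<lambda>l k y. matrix_inv (G y) $ l $ k"
  let ?P = "\<lambda>k l i j y. ?J l k y * (Q k i y * cnj (Q l j y) * T y $ i $ j)"
  have J: "?J l k differentiable (at y)" if "y \<in> S" for l k y
    by (rule differentiable_matrix_inv[OF S(1) that G(3) G(1)[OF that]])
  note J2 = wirtinger_wirtinger_bar_matrix_inv[OF S G(3) G(1) G(2) G(5)]
  have J2a: "wirtinger a (?J l k) x = - wirtinger a (\<lambda>y. G y $ l $ k) x" for l k
    by (rule J2(2))
  have J2b: "wirtinger_bar b (?J l k) x = - wirtinger_bar b (\<lambda>y. G y $ l $ k) x" for l k
    by (rule J2(3))
  have J2c: "wirtinger a (wirtinger_bar b (?J l k)) x =
      - wirtinger a (wirtinger_bar b (\<lambda>y. G y $ l $ k)) x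
      + (\<Sum>s\<in>UNIV. wirtinger a (\<lambda>y. G y $ l $ s) x * wirtinger_bar b (\<lambda>y. G y $ s $ k) x)
      + (\<Sum>s\<in>UNIV. wirtinger_bar b (\<lambda>y. G y $ l $ s) x * wirtinger a (\<lambda>y. G y $ s $ k) x)" for l k
    by (rule J2(4))
  have d: "?P k l i j differentiable (at y)" if "y \<in> S" for k l i j y
    using Q that by (intro differentiable_mult differentiable_cnj J T(1)) (auto simp: holo_at_def)
  note prod = wirtinger_wirtinger_bar_product[OF S J J2(1) T(1) T(2) Q Q]
  have d': "wirtinger_bar b (?P k l i j) differentiable (at x)" for k l i j
    by (rule prod(2))
  note sum_rule = wirtinger_wirtinger_bar_sum[OF S finite]
  \<comment> \<open>The four sums are treated from the inside out: each use of the rule requires the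
    inner sum to be differentiable near \<open>x\<close> and its barred derivative to be
    differentiable at \<open>x\<close>.\<close>
  have s1: "wirtinger_bar b (\<lambda>y. \<Sum>j\<in>UNIV. ?P k l i j y) differentiable (at x)"
    "wirtinger a (wirtinger_bar b (\<lambda>y. \<Sum>j\<in>UNIV. ?P k l i j y)) x
      = (\<Sum>j\<in>UNIV. wirtinger a (wirtinger_bar b (?P k l i j)) x)" for k l i
    by (rule sum_rule(1); simp only: d d') (rule sum_rule(2); simp only: d d')
  have d1: "(\<lambda>y. \<Sum>j\<in>UNIV. ?P k l i j y) differentiable (at y)" if "y \<in> S" for k l i y
    by (rule differentiable_sum) (simp_all only: finite d that ball_UNIV HOL.simp_thms)
  have s2: "wirtinger_bar b (\<lambda>y. \<Sum>i\<in>UNIV. \<Sum>j\<in>UNIV. ?P k l i j y) differentiable (at x)"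
    "wirtinger a (wirtinger_bar b (\<lambda>y. \<Sum>i\<in>UNIV. \<Sum>j\<in>UNIV. ?P k l i j y)) x
      = (\<Sum>i\<in>UNIV. wirtinger a (wirtinger_bar b (\<lambda>y. \<Sum>j\<in>UNIV. ?P k l i j y)) x)" for k l
    by (rule sum_rule(1); simp only: d1 s1(1)) (rule sum_rule(2); simp only: d1 s1(1))
  have d2: "(\<lambda>y. \<Sum>i\<in>UNIV. \<Sum>j\<in>UNIV. ?P k l i j y) differentiable (at y)" if "y \<in> S" for k l y
    by (rule differentiable_sum) (simp_all only: finite d1 that ball_UNIV HOL.simp_thms)
  have s3: "wirtinger_bar b (\<lambda>y. \<Sum>l\<in>UNIV. \<Sum>i\<in>UNIV. \<Sum>j\<in>UNIV. ?P k l i j y) differentiable (at x)"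
    "wirtinger a (wirtinger_bar b (\<lambda>y. \<Sum>l\<in>UNIV. \<Sum>i\<in>UNIV. \<Sum>j\<in>UNIV. ?P k l i j y)) x
      = (\<Sum>l\<in>UNIV. wirtinger a (wirtinger_bar b (\<lambda>y. \<Sum>i\<in>UNIV. \<Sum>j\<in>UNIV. ?P k l i j y)) x)" for k
    by (rule sum_rule(1); simp only: d2 s2(1)) (rule sum_rule(2); simp only: d2 s2(1))
  have d3: "(\<lambda>y. \<Sum>l\<in>UNIV. \<Sum>i\<in>UNIV. \<Sum>j\<in>UNIV. ?P k l i j y) differentiable (at y)" if "y \<in> S" for k y
    by (rule differentiable_sum) (simp_all only: finite d2 that ball_UNIV HOL.simp_thms)
  have s4: "wirtinger_bar b (\<lambda>y. \<Sum>k\<in>UNIV. \<Sum>l\<in>UNIV. \<Sum>i\<in>UNIV. \<Sum>j\<in>UNIV. ?P k l i j y) differentiable (at x)"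
    "wirtinger a (wirtinger_bar b (\<lambda>y. \<Sum>k\<in>UNIV. \<Sum>l\<in>UNIV. \<Sum>i\<in>UNIV. \<Sum>j\<in>UNIV. ?P k l i j y)) x
      = (\<Sum>k\<in>UNIV. wirtinger a (wirtinger_bar b (\<lambda>y. \<Sum>l\<in>UNIV. \<Sum>i\<in>UNIV. \<Sum>j\<in>UNIV. ?P k l i j y)) x)"
    by (rule sum_rule(1); simp only: d3 s3(1)) (rule sum_rule(2); simp only: d3 s3(1))
  have Gbar: "wirtinger_bar b (\<lambda>y. G y $ k $ l) x = cnj (wirtinger b (\<lambda>y. G y $ l $ k) x)" for k l
    by (rule wirtinger_bar_hermitian[OF S _ G(1)[OF S(2)]]) (rule G(4))
  have Tbar: "wirtinger_bar b (\<lambda>y. T y $ i $ j) x = cnj (wirtinger b (\<lambda>y. T y $ j $ i) x)" for i j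
    by (rule wirtinger_bar_hermitian[OF S _ T(1)[OF S(2)]]) (rule T(3))
  have "matrix_inv (G x) = mat 1"
    by (metis G(5) matrix_inv_inverse(2) det_I matrix_mul_rid zero_neq_one)
  then have Jx: "?J l k x = (if k = l then 1 else 0)" for l k
    by (simp add: mat_def eq_commute)
  have Tx: "T x $ i $ j = (if i = j then 1 else 0)" for i j
    by (simp add: T(4) mat_def)
  have "wirtinger a (wirtinger_bar b (\<lambda>y. \<Sum>k\<in>UNIV. \<Sum>l\<in>UNIV. \<Sum>i\<in>UNIV. \<Sum>j\<in>UNIV. ?P k l i j y)) x
      = (\<Sum>k\<in>UNIV. \<Sum>l\<in>UNIV. \<Sum>i\<in>UNIV. \<Sum>j\<in>UNIV. wirtinger a (wirtinger_bar b (?P k l i j)) x)"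
    by (simp only: s4(2) s3(2) s2(2) s1(2))
  also have "\<dots> = (\<Sum>k\<in>UNIV. \<Sum>l\<in>UNIV. \<Sum>i\<in>UNIV. \<Sum>j\<in>UNIV.
      wirtinger a (wirtinger_bar b (?J l k)) x * (Q k i x * cnj (Q l j x) * T x $ i $ j)
      + wirtinger_bar b (?J l k) x * (wirtinger a (Q k i) x * cnj (Q l j x) * T x $ i $ j)
      + wirtinger_bar b (?J l k) x * (Q k i x * cnj (Q l j x) * wirtinger a (\<lambda>y. T y $ i $ j) x)
      + wirtinger a (?J l k) x * (Q k i x * cnj (wirtinger b (Q l j) x) * T x $ i $ j)
      + ?J l k x * (wirtinger a (Q k i) x * cnj (wirtinger b (Q l j) x) * T x $ i $ j)
      + ?J l k x * (Q k i x * cnj (wirtinger b (Q l j) x) * wirtinger a (\<lambda>y. T y $ i $ j) x)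
      + wirtinger a (?J l k) x * (Q k i x * cnj (Q l j x) * wirtinger_bar b (\<lambda>y. T y $ i $ j) x)
      + ?J l k x * (wirtinger a (Q k i) x * cnj (Q l j x) * wirtinger_bar b (\<lambda>y. T y $ i $ j) x)
      + ?J l k x * (Q k i x * cnj (Q l j x) * wirtinger a (wirtinger_bar b (\<lambda>y. T y $ i $ j)) x))"
    by (intro sum.cong refl prod(3))
  also have "\<dots> = (\<Sum>k\<in>UNIV. \<Sum>l\<in>UNIV. \<Sum>i\<in>UNIV. \<Sum>j\<in>UNIV.
      (- wirtinger a (wirtinger_bar b (\<lambda>y. G y $ l $ k)) x
        + (\<Sum>s\<in>UNIV. wirtinger a (\<lambda>y. G y $ l $ s) x * cnj (wirtinger b (\<lambda>y. G y $ k $ s) x))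
        + (\<Sum>s\<in>UNIV. cnj (wirtinger b (\<lambda>y. G y $ s $ l) x) * wirtinger a (\<lambda>y. G y $ s $ k) x))
          * (Q k i x * cnj (Q l j x) * (if i = j then 1 else 0))
      + (- cnj (wirtinger b (\<lambda>y. G y $ k $ l) x)) * (wirtinger a (Q k i) x * cnj (Q l j x) * (if i = j then 1 else 0))
      + (- cnj (wirtinger b (\<lambda>y. G y $ k $ l) x)) * (Q k i x * cnj (Q l j x) * wirtinger a (\<lambda>y. T y $ i $ j) x)
      + (- wirtinger a (\<lambda>y. G y $ l $ k) x) * (Q k i x * cnj (wirtinger b (Q l j) x) * (if i = j then 1 else 0))
      + (if k = l then 1 else 0) * (wirtinger a (Q k i) x * cnj (wirtinger b (Q l j) x) * (if i = j then 1 else 0))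
      + (if k = l then 1 else 0) * (Q k i x * cnj (wirtinger b (Q l j) x) * wirtinger a (\<lambda>y. T y $ i $ j) x)
      + (- wirtinger a (\<lambda>y. G y $ l $ k) x) * (Q k i x * cnj (Q l j x) * cnj (wirtinger b (\<lambda>y. T y $ j $ i) x))
      + (if k = l then 1 else 0) * (wirtinger a (Q k i) x * cnj (Q l j x) * cnj (wirtinger b (\<lambda>y. T y $ j $ i) x))
      + (if k = l then 1 else 0) * (Q k i x * cnj (Q l j x) * wirtinger a (wirtinger_bar b (\<lambda>y. T y $ i $ j)) x))"
    by (simp only: J2a J2b J2c Jx Tx Gbar Tbar)
  finally show ?thesis
    unfolding N_def Gbar Tbar bochner_algebra .
qed

text \<open>Smoothness is given for the matrix-valued map through directional derivatives. Taking an
  entry is bounded linear and commutes with them, and \<open>wirtinger_bar\<close> combines just two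
  directions, so two orders of differentiability suffice.\<close>

lemma Ck_on_2_components:
  fixes M :: "complex^'m::finite \<Rightarrow> complex^'n::finite^'k::finite"
  assumes M: "Ck_on 2 M S" and S: "open S" "x \<in> S"
  shows "(\<lambda>y. M y $ i $ j) differentiable (at x)"
    and "wirtinger_bar t (\<lambda>y. M y $ i $ j) differentiable (at x)"
proof -
  have M1: "M differentiable (at y)" if "y \<in> S" for y
    using M that by (simp add: numeral_2_eq_2)
  have M2: "(\<lambda>y. frechet_derivative M (at y) v) differentiable (at x)" for v
    using M S(2) by (simp add: numeral_2_eq_2)
  have L: "bounded_linear (\<lambda>A::complex^'n^'k. A $ i $ j)"
    using bounded_linear_compose[OF bounded_linear_vec_nth bounded_linear_vec_nth] .
  have D: "((\<lambda>y. M y $ i $ j) has_derivative (\<lambda>v. frechet_derivative M (at y) v $ i $ j)) (at y)"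
    if "y \<in> S" for y
    using bounded_linear.has_derivative[OF L] M1[OF that] by (simp add: frechet_derivative_works)
  then show "(\<lambda>y. M y $ i $ j) differentiable (at x)"
    using S(2) by (auto simp: differentiable_def)
  have D2: "(\<lambda>y. frechet_derivative M (at y) v $ i $ j) differentiable (at x)" for v
    using bounded_linear.has_derivative[OF L] M2[of v] unfolding differentiable_def by blast
  show "wirtinger_bar t (\<lambda>y. M y $ i $ j) differentiable (at x)"
  proof (rule differentiable_cong_open[OF S])
    show "(frechet_derivative M (at y) (axis t 1) $ i $ j
        + \<i> * frechet_derivative M (at y) (axis t \<i>) $ i $ j) / 2 = wirtinger_bar t (\<lambda>y. M y $ i $ j) y"
      if "y \<in> S" for y
      using wirtinger_eqI(2)[OF D[OF that], of t] by simp
    show "(\<lambda>y. (frechet_derivative M (at y) (axis t 1) $ i $ j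
        + \<i> * frechet_derivative M (at y) (axis t \<i>) $ i $ j) / 2) differentiable (at x)"
      by (intro differentiable_divide differentiable_add differentiable_mult differentiable_const D2) simp
  qed
qed

text \<open>A nonzero kernel vector of \<open>A\<close> would make the form vanish. The test vector
  is its conjugate, since the second slot of the form is conjugated and must reproduce the kernel
  vector.\<close>

lemma det_nonzero_if_positive:
  fixes A :: "complex^'m::finite^'m"
  assumes "\<And>v. v \<noteq> 0 \<Longrightarrow> Re (\<Sum>a\<in>UNIV. \<Sum>b\<in>UNIV. A $ a $ b * v $ a * cnj (v $ b)) > 0"
  shows "det A \<noteq> 0"
proof -
  have "x = 0" if x: "A *v x = 0" for x
  proof (rule ccontr)
    assume "x \<noteq> 0"
    let ?v = "\<chi> i. cnj (x $ i)"
    have "?v \<noteq> 0"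
      using \<open>x \<noteq> 0\<close> by (auto simp: vec_eq_iff)
    have "(\<Sum>a\<in>UNIV. \<Sum>b\<in>UNIV. A $ a $ b * ?v $ a * cnj (?v $ b)) = (\<Sum>a\<in>UNIV. ?v $ a * (A *v x) $ a)"
      by (simp add: matrix_vector_mult_def sum_distrib_left mult_ac)
    also have "\<dots> = 0"
      by (simp add: x)
    finally show False
      using assms[OF \<open>?v \<noteq> 0\<close>] by (simp only: zero_complex.sel less_irrefl)
  qed
  then show ?thesis
    by (metis matrix_left_invertible_ker invertible_left_inverse invertible_det_nz)
qed

section \<open>Passage to charts\<close>

lemma chart_inj_on:
  assumes "is_chart X c"
  shows "inj_on (snd c) (fst c)"
proof -
  have "topspace (subtopology X (fst c)) = fst c"
    using assms openin_subset by (force simp: is_chart_def)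
  then show ?thesis
    using assms homeomorphic_imp_injective_map unfolding is_chart_def by metis
qed

lemma chart_inv_apply:
  assumes "is_chart X c"
  shows "q \<in> fst c \<Longrightarrow> chart_inv c (snd c q) = q"
    and "y \<in> snd c ` fst c \<Longrightarrow> chart_inv c y \<in> fst c"
    and "y \<in> snd c ` fst c \<Longrightarrow> snd c (chart_inv c y) = y"
  using chart_inj_on[OF assms] by (auto simp: chart_inv_def inv_into_f_f)

lemma open_chart_image:
  assumes c: "is_chart X c" and U: "openin X U" "U \<subseteq> fst c"
  shows "open (snd c ` U)"
proof -
  have "open_map (subtopology X (fst c)) (top_of_set (snd c ` fst c)) (snd c)"
    using c by (simp add: is_chart_def homeomorphic_imp_open_map)
  moreover have "openin (subtopology X (fst c)) U"
    using U by (metis inf.absorb1 openin_subtopology_Int)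
  ultimately have "openin (top_of_set (snd c ` fst c)) (snd c ` U)"
    by (simp add: open_map_def)
  then show ?thesis
    using c by (simp add: is_chart_def openin_open_eq)
qed

text \<open>The outer derivative looks at \<open>pd_bar c b F\<close> at neighbouring points, each
  with its own coordinate vector. The inner derivative is therefore identified on all of
  \<open>S\<close> before the outer one is compared at \<open>q\<close>.\<close>

lemma pd_pd_bar_eq_wirtinger:
  assumes c: "is_chart X c" and S: "open S" "S \<subseteq> snd c ` fst c" "q \<in> fst c" "snd c q \<in> S"
    and F: "\<And>y. y \<in> S \<Longrightarrow> F (chart_inv c y) = F' y"
  shows "pd c a (pd_bar c b F) q = wirtinger a (wirtinger_bar b F') (snd c q)"
  unfolding pd_def
proof (rule wirtinger_cong(1)[OF S(1,4)])
  fix y assume y: "y \<in> S"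
  then have "snd c (chart_inv c y) = y"
    using S(2) chart_inv_apply(3)[OF c] by blast
  then have "(pd_bar c b F \<circ> chart_inv c) y = wirtinger_bar b (F \<circ> chart_inv c) y"
    by (simp add: pd_bar_def)
  also have "\<dots> = wirtinger_bar b F' y"
    by (rule wirtinger_cong(2)[OF S(1) y]) (simp add: F)
  finally show "(pd_bar c b F \<circ> chart_inv c) y = wirtinger_bar b F' y" .
qed

lemma pd_eq_wirtinger:
  assumes "open S" "snd c q \<in> S" "\<And>y. y \<in> S \<Longrightarrow> F (chart_inv c y) = F' y"
  shows "pd c a F q = wirtinger a F' (snd c q)" "pd_bar c a F q = wirtinger_bar a F' (snd c q)"
  unfolding pd_def pd_bar_def using assms by (intro wirtinger_cong[of S]; simp)+

lemma hermitian_metric_chart: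
  fixes g :: "('a, 'm::finite) metric"
  assumes g: "hermitian_metric A g" and c: "c \<in> A" "is_chart X c" and y: "y \<in> snd c ` fst c"
  defines "G \<equiv> \<lambda>y. g c (chart_inv c y)"
  shows "(\<lambda>y. G y $ k $ l) differentiable (at y)"
    and "wirtinger_bar b (\<lambda>y. G y $ k $ l) differentiable (at y)"
    and "det (G y) \<noteq> 0"
    and "G y $ l $ k = cnj (G y $ k $ l)"
proof -
  have q: "chart_inv c y \<in> fst c"
    using chart_inv_apply(2)[OF c(2) y] .
  have "Ck_on 2 G (snd c ` fst c)"
    using g c(1) by (auto simp: hermitian_metric_def smooth_fun_on_def G_def comp_def)
  moreover have "open (snd c ` fst c)"
    using c(2) by (simp add: is_chart_def)
  ultimately show "(\<lambda>y. G y $ k $ l) differentiable (at y)"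
    "wirtinger_bar b (\<lambda>y. G y $ k $ l) differentiable (at y)"
    using y by (rule Ck_on_2_components)+
  show "det (G y) \<noteq> 0"
    using g c(1) q unfolding hermitian_metric_def G_def by (intro det_nonzero_if_positive) blast
  show "G y $ l $ k = cnj (G y $ k $ l)"
    using g c(1) q unfolding hermitian_metric_def G_def by blast
qed

lemma holomorphic_vec_on_component:
  assumes "F holomorphic_vec_on S" "x \<in> S"
  shows "holo_at (\<lambda>y. F y $ i) x"
proof -
  obtain L where L: "(F has_derivative L) (at x)" "\<And>c v. L (c *s v) = c *s L v"
    using assms by (auto simp: holomorphic_vec_on_def)
  show ?thesis
    by (rule holo_atI[OF bounded_linear.has_derivative[OF bounded_linear_vec_nth L(1)]]) (simp add: L(2))
qed

lemma metric_inv_orthonormal: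
  assumes "\<And>a b. g c q $ a $ b = (if a = b then 1 else 0)"
  shows "metric_inv g c q a b = (if a = b then 1 else 0)"
proof -
  have id: "g c q = mat 1"
    using assms by (simp add: vec_eq_iff mat_def)
  then have "matrix_inv (g c q) = mat 1"
    by (metis matrix_inv_inverse(2) det_I matrix_mul_rid zero_neq_one)
  then show ?thesis
    by (simp add: metric_inv_def mat_def eq_commute)
qed

lemma sum_delta_mult:
  fixes u :: "'b::finite \<Rightarrow> complex"
  shows "(\<Sum>j\<in>UNIV. (if i = j then 1 else 0) * u j) = u i"
    "(\<Sum>j\<in>UNIV. u j * (if i = j then 1 else 0)) = u i"
    "(\<Sum>j\<in>UNIV. (if j = i then 1 else 0) * u j) = u i"
    "(\<Sum>j\<in>UNIV. u j * (if j = i then 1 else 0)) = u i"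
  by (simp_all add: if_distrib[of "\<lambda>v. v * _"] if_distrib[of "\<lambda>v. _ * v"] cong: if_cong)

text \<open>The differential of \<open>f\<close> is left arbitrary here, so the target curvature is
  contracted with two factors \<open>map_pd\<close> in its first two slots; diagonality enters only
  afterwards.\<close>

lemma pd_pd_bar_U_fun:
  fixes A :: "('a, 'm::finite) chart set" and B :: "('b, 'n::finite) chart set"
    and \<mu> :: "nat \<Rightarrow> 'm"
  assumes M: "complex_manifold X A" "hermitian_metric A g"
    and N: "complex_manifold Y B" "hermitian_metric B h"
    and f: "holomorphic_map X A Y B f"
    and z: "z \<in> A" "p \<in> fst z"
    and w: "w \<in> B" "f p \<in> fst w"
    and g_p: "\<And>a b. g z p $ a $ b = (if a = b then 1 else 0)"
    and h_fp: "\<And>i j. h w (f p) $ i $ j = (if i = j then 1 else 0)"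
    and inj: "inj_on \<mu> {1..l}"
  defines "V \<equiv> V_section \<mu> l z w f"
  shows "pd z a (pd_bar z b (U_fun \<mu> l z w g h f)) p
    = (\<Sum>k\<in>UNIV. \<Sum>k'\<in>UNIV. \<Sum>i\<in>UNIV. chern_curvature g z a b k' k p * (V k i p * cnj (V k' i p)))
      - (\<Sum>k\<in>UNIV. \<Sum>i\<in>UNIV. \<Sum>j\<in>UNIV.
          (\<Sum>s\<in>UNIV. \<Sum>t\<in>UNIV. map_pd z w f s a p * cnj (map_pd z w f t b p) *
            chern_curvature h w s t i j (f p)) * (V k i p * cnj (V k j p)))
      + E_inner z w g h f p (E_nabla z w g h f a V p) (E_nabla z w g h f b V p)"
proof -
  have zc: "is_chart X z" and wc: "is_chart Y w"
    using M(1) N(1) z(1) w(1) by (auto simp: complex_manifold_def)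
  \<comment> \<open>Where \<open>f\<close> lands in the chart \<open>w\<close>. Continuity of
    \<open>f\<close> makes this set open, so its image \<open>S\<close> is an open neighbourhood of
    \<open>x\<close> on which both charts can be used.\<close>
  define D where "D = {q \<in> fst z. f q \<in> fst w}"
  define S where "S = snd z ` D"
  define \<phi> where "\<phi> = snd w \<circ> f \<circ> chart_inv z"
  define x where "x = snd z p"
  define G where "G = (\<lambda>y. g z (chart_inv z y))"
  define H where "H = (\<lambda>v. h w (chart_inv w v))"
  define T where "T = (\<lambda>y. H (\<phi> y))"
  \<comment> \<open>The components of V padded with 0 outside the first \<open>l\<close> indices:
    all sums then run over the full index types, and every component remains holomorphic.\<close>
  define Q where "Q = (\<lambda>k i y. if k \<in> \<mu> ` {1..l} then wirtinger k (\<lambda>y. \<phi> y $ i) y else 0)"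
  have "openin X {q \<in> topspace X. f q \<in> fst w}"
    using f wc openin_continuous_map_preimage by (auto simp: holomorphic_map_def is_chart_def)
  moreover have "openin X (fst z)"
    using zc by (simp add: is_chart_def)
  ultimately have "openin X ({q \<in> topspace X. f q \<in> fst w} \<inter> fst z)"
    by (rule openin_Int)
  moreover have "{q \<in> topspace X. f q \<in> fst w} \<inter> fst z = D"
    using openin_subset[OF \<open>openin X (fst z)\<close>] by (auto simp: D_def)
  ultimately have S: "open S"
    unfolding S_def by (intro open_chart_image[OF zc]) (auto simp: D_def)
  have pD: "p \<in> D" and xS: "x \<in> S"
    using z(2) w(2) by (auto simp: D_def S_def x_def)
  have Ssub: "S \<subseteq> snd z ` fst z"
    by (auto simp: S_def D_def)
  have zinv: "chart_inv z y \<in> D" "snd z (chart_inv z y) = y" if "y \<in> S" for y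
    using that chart_inv_apply(1)[OF zc] by (auto simp: S_def D_def)
  have \<phi>w: "\<phi> y \<in> snd w ` fst w" "chart_inv w (\<phi> y) = f (chart_inv z y)" if "y \<in> S" for y
    using zinv(1)[OF that] chart_inv_apply(1)[OF wc] by (auto simp: \<phi>_def D_def)
  have xp: "chart_inv z x = p"
    using chart_inv_apply(1)[OF zc z(2)] by (simp add: x_def)
  have \<phi>x: "\<phi> x = snd w (f p)"
    by (simp add: \<phi>_def xp)
  have \<phi>: "holo_at (\<lambda>y. \<phi> y $ i) y" if "y \<in> S" for y i
  proof (rule holomorphic_vec_on_component[OF _ that])
    show "\<phi> holomorphic_vec_on S"
      using f z(1) w(1) unfolding \<phi>_def S_def D_def holomorphic_map_def by blast
  qed
  have Gm: "(\<lambda>y. G y $ k $ l) differentiable (at y)" "wirtinger_bar b (\<lambda>y. G y $ k $ l) differentiable (at y)"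
    "det (G y) \<noteq> 0" "G y $ l $ k = cnj (G y $ k $ l)" if "y \<in> S" for y k l
    using hermitian_metric_chart[OF M(2) z(1) zc, of y] that Ssub unfolding G_def by blast+
  have Hm: "(\<lambda>y. H y $ i $ j) differentiable (at y)" "wirtinger_bar t (\<lambda>y. H y $ i $ j) differentiable (at y)"
    "H y $ j $ i = cnj (H y $ i $ j)" if "y \<in> snd w ` fst w" for y i j t
    using hermitian_metric_chart[OF N(2) w(1) wc, of y] that unfolding H_def by blast+
  note Hw = Hm[OF \<phi>w(1)]
  note \<phi>1 = wirtinger_chain[OF \<phi> Hw(1)]
  note \<phi>2 = wirtinger_wirtinger_bar_compose[OF S xS \<phi> Hw(1) Hw(2)[OF xS]]
  have Td: "(\<lambda>y. T y $ i $ j) differentiable (at y)" if "y \<in> S" for y i j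
    unfolding T_def by (rule \<phi>1(1)[OF that that])
  have Td2: "wirtinger_bar b (\<lambda>y. T y $ i $ j) differentiable (at x)" for i j
    unfolding T_def by (rule \<phi>2(1))
  have Th: "T y $ j $ i = cnj (T y $ i $ j)" if "y \<in> S" for y i j
    unfolding T_def by (rule Hw(3)[OF that])
  have Gx: "G x = mat 1"
    by (simp add: G_def xp vec_eq_iff mat_def g_p)
  have Tx: "T x = mat 1"
    using \<phi>w(2)[OF xS] by (simp add: T_def H_def xp vec_eq_iff mat_def h_fp)
  have Qh: "holo_at (Q k i) y" if "y \<in> S" for k i y
    using holo_at_wirtinger[OF S that \<phi>, of k i]
    by (cases "k \<in> \<mu> ` {1..l}") (auto simp: Q_def holo_at_def)
  have map_pd_S: "map_pd z w f i k (chart_inv z y) = wirtinger k (\<lambda>y. \<phi> y $ i) y" if "y \<in> S" for i k y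
    using zinv(2)[OF that] by (simp add: map_pd_def pd_def \<phi>_def comp_def)
  then have map_pd_p: "map_pd z w f i k p = wirtinger k (\<lambda>y. \<phi> y $ i) x" for i k
    using xS xp by metis
  have VS: "V k i (chart_inv z y) = Q k i y" if "y \<in> S" for k i y
    using map_pd_S[OF that] by (simp add: V_def V_section_def Q_def)
  then have Vp: "V k i p = Q k i x" for k i
    using xS xp by metis
  have restrict: "(\<Sum>\<alpha>=1..l. F (\<mu> \<alpha>)) = (\<Sum>k\<in>UNIV. if k \<in> \<mu> ` {1..l} then F k else 0)"
    for F :: "'m \<Rightarrow> complex"
  proof -
    have "(\<Sum>\<alpha>=1..l. F (\<mu> \<alpha>)) = (\<Sum>k\<in>\<mu> ` {1..l}. F k)"
      unfolding sum.reindex[OF inj] comp_def ..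
    also have "\<dots> = (\<Sum>k\<in>UNIV. if k \<in> \<mu> ` {1..l} then F k else 0)"
      by (simp add: sum.If_cases)
    finally show ?thesis .
  qed
  have US: "U_fun \<mu> l z w g h f (chart_inv z y)
      = (\<Sum>k\<in>UNIV. \<Sum>k'\<in>UNIV. \<Sum>i\<in>UNIV. \<Sum>j\<in>UNIV.
          matrix_inv (G y) $ k' $ k * (Q k i y * cnj (Q k' j y) * T y $ i $ j))" if y: "y \<in> S" for y
  proof -
    let ?K = "\<lambda>k k'. matrix_inv (G y) $ k' $ k *
      (\<Sum>i\<in>UNIV. \<Sum>j\<in>UNIV. wirtinger k (\<lambda>y. \<phi> y $ i) y * cnj (wirtinger k' (\<lambda>y. \<phi> y $ j) y) * T y $ i $ j)"
    have "U_fun \<mu> l z w g h f (chart_inv z y) = (\<Sum>\<alpha>=1..l. \<Sum>\<beta>=1..l. ?K (\<mu> \<alpha>) (\<mu> \<beta>))"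
      unfolding U_fun_def pullback_metric_def map_pd_S[OF y] metric_inv_def
      by (simp only: G_def T_def H_def \<phi>w(2)[OF y])
    also have "\<dots> = (\<Sum>\<alpha>=1..l. \<Sum>k'\<in>UNIV. if k' \<in> \<mu> ` {1..l} then ?K (\<mu> \<alpha>) k' else 0)"
      by (simp only: restrict[of "?K (\<mu> \<alpha>)" for \<alpha>])
    also have "\<dots> = (\<Sum>k\<in>UNIV. if k \<in> \<mu> ` {1..l} then
        \<Sum>k'\<in>UNIV. if k' \<in> \<mu> ` {1..l} then ?K k k' else 0 else 0)"
      by (rule restrict[of "\<lambda>k. \<Sum>k'\<in>UNIV. if k' \<in> \<mu> ` {1..l} then ?K k k' else 0"])
    also have "\<dots> = (\<Sum>k\<in>UNIV. \<Sum>k'\<in>UNIV.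
        if k \<in> \<mu> ` {1..l} then if k' \<in> \<mu> ` {1..l} then ?K k k' else 0 else 0)"
      by (intro sum.cong refl) simp
    also have "\<dots> = (\<Sum>k\<in>UNIV. \<Sum>k'\<in>UNIV. \<Sum>i\<in>UNIV. \<Sum>j\<in>UNIV.
          matrix_inv (G y) $ k' $ k * (Q k i y * cnj (Q k' j y) * T y $ i $ j))"
      by (intro sum.cong refl) (simp add: Q_def sum_distrib_left)
    finally show ?thesis .
  qed
  have mg: "metric_inv g z p s t = (if s = t then 1 else 0)" for s t
    by (rule metric_inv_orthonormal) (rule g_p)
  have mh: "metric_inv h w (f p) s t = (if s = t then 1 else 0)" for s t
    by (rule metric_inv_orthonormal) (rule h_fp)
  have Gpd: "pd z c (\<lambda>r. g z r $ k $ k') p = wirtinger c (\<lambda>y. G y $ k $ k') x"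
    "pd_bar z c (\<lambda>r. g z r $ k $ k') p = wirtinger_bar c (\<lambda>y. G y $ k $ k') x" for c k k'
    unfolding x_def by (rule pd_eq_wirtinger[OF S], use xS in \<open>simp add: x_def\<close>, simp add: G_def)+
  have RM: "chern_curvature g z a b k k' p = - wirtinger a (wirtinger_bar b (\<lambda>y. G y $ k $ k')) x
      + (\<Sum>s\<in>UNIV. wirtinger a (\<lambda>y. G y $ k $ s) x * wirtinger_bar b (\<lambda>y. G y $ s $ k') x)" for k k'
  proof -
    have "pd z a (pd_bar z b (\<lambda>r. g z r $ k $ k')) p = wirtinger a (wirtinger_bar b (\<lambda>y. G y $ k $ k')) x"
      unfolding x_def by (rule pd_pd_bar_eq_wirtinger[OF zc S Ssub z(2)]) (use xS in \<open>simp_all add: x_def G_def\<close>)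
    then show ?thesis
      unfolding chern_curvature_def Gpd mg mult.assoc
      by (simp add: sum_delta_mult flip: sum_distrib_left)
  qed
  have W: "open (snd w ` fst w)" "snd w (f p) \<in> snd w ` fst w"
    using wc w(2) by (auto simp: is_chart_def)
  have Hpd: "pd w c (\<lambda>r. h w r $ i $ j) (f p) = wirtinger c (\<lambda>y. H y $ i $ j) (\<phi> x)"
    "pd_bar w c (\<lambda>r. h w r $ i $ j) (f p) = wirtinger_bar c (\<lambda>y. H y $ i $ j) (\<phi> x)" for c i j
    unfolding \<phi>x by (rule pd_eq_wirtinger[OF W]; simp add: H_def)+
  have RN0: "chern_curvature h w s t i j (f p) = - wirtinger s (wirtinger_bar t (\<lambda>y. H y $ i $ j)) (\<phi> x)
      + (\<Sum>u\<in>UNIV. wirtinger s (\<lambda>y. H y $ i $ u) (\<phi> x) * wirtinger_bar t (\<lambda>y. H y $ u $ j) (\<phi> x))" for s t i j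
  proof -
    have "pd w s (pd_bar w t (\<lambda>r. h w r $ i $ j)) (f p) = wirtinger s (wirtinger_bar t (\<lambda>y. H y $ i $ j)) (\<phi> x)"
      unfolding \<phi>x by (rule pd_pd_bar_eq_wirtinger[OF wc W(1) order_refl w(2) W(2)]) (simp add: H_def)
    then show ?thesis
      unfolding chern_curvature_def Hpd mh mult.assoc
      by (simp add: sum_delta_mult flip: sum_distrib_left)
  qed
  have dT: "wirtinger c (\<lambda>y. T y $ i $ j) x =
      (\<Sum>s\<in>UNIV. map_pd z w f s c p * wirtinger s (\<lambda>y. H y $ i $ j) (\<phi> x))"
    "wirtinger_bar c (\<lambda>y. T y $ i $ j) x =
      (\<Sum>s\<in>UNIV. cnj (map_pd z w f s c p) * wirtinger_bar s (\<lambda>y. H y $ i $ j) (\<phi> x))" for c i j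
    unfolding T_def map_pd_p by (rule \<phi>1(2)[OF xS xS], rule \<phi>1(3)[OF xS xS])
  have ddT: "wirtinger a (wirtinger_bar b (\<lambda>y. T y $ i $ j)) x =
      (\<Sum>s\<in>UNIV. \<Sum>t\<in>UNIV. map_pd z w f s a p * cnj (map_pd z w f t b p) *
        wirtinger s (wirtinger_bar t (\<lambda>y. H y $ i $ j)) (\<phi> x))" for i j
    unfolding T_def map_pd_p by (rule \<phi>2(2))
  \<comment> \<open>The first derivatives of \<open>T\<close> carry one factor \<open>map_pd\<close>
    each, so the quadratic part has the same two factors as \<open>ddT\<close> and both combine to
    the curvature of \<open>h\<close>.\<close>
  have RN: "- wirtinger a (wirtinger_bar b (\<lambda>y. T y $ i $ j)) x
      + (\<Sum>u\<in>UNIV. wirtinger a (\<lambda>y. T y $ i $ u) x * wirtinger_bar b (\<lambda>y. T y $ u $ j) x)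
      = (\<Sum>s\<in>UNIV. \<Sum>t\<in>UNIV. map_pd z w f s a p * cnj (map_pd z w f t b p) *
            chern_curvature h w s t i j (f p))" for i j
  proof -
    let ?m = "\<lambda>s t. map_pd z w f s a p * cnj (map_pd z w f t b p)"
    let ?h = "\<lambda>s t u. wirtinger s (\<lambda>y. H y $ i $ u) (\<phi> x) * wirtinger_bar t (\<lambda>y. H y $ u $ j) (\<phi> x)"
    have "(\<Sum>u\<in>UNIV. wirtinger a (\<lambda>y. T y $ i $ u) x * wirtinger_bar b (\<lambda>y. T y $ u $ j) x)
        = (\<Sum>u\<in>UNIV. \<Sum>s\<in>UNIV. \<Sum>t\<in>UNIV. ?m s t * ?h s t u)"
      unfolding dT sum_product by (simp add: mult_ac)
    also have "\<dots> = (\<Sum>s\<in>UNIV. \<Sum>u\<in>UNIV. \<Sum>t\<in>UNIV. ?m s t * ?h s t u)"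
      by (rule sum.swap)
    also have "\<dots> = (\<Sum>s\<in>UNIV. \<Sum>t\<in>UNIV. \<Sum>u\<in>UNIV. ?m s t * ?h s t u)"
      by (rule sum.cong[OF refl sum.swap])
    finally show ?thesis
      unfolding ddT RN0 distrib_left sum.distrib sum_distrib_left by (simp add: sum_negf)
  qed
  \<comment> \<open>At \<open>p\<close> both inverse metrics are Kronecker deltas, which reduces the
    connection coefficients to first derivatives; the minus sign and the index order
    \<open>k\<close>, \<open>j\<close> stem from the dual connection.\<close>
  have nabla: "E_nabla z w g h f c V p k i = wirtinger c (Q k i) x
      - (\<Sum>j\<in>UNIV. Q j i x * wirtinger c (\<lambda>y. G y $ k $ j) x)
      + (\<Sum>j\<in>UNIV. Q k j x * wirtinger c (\<lambda>y. T y $ j $ i) x)" for c k i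
  proof -
    have "pd z c (V k i) p = wirtinger c (Q k i) x"
      unfolding x_def by (rule pd_eq_wirtinger(1)[OF S]) (use xS VS in \<open>simp_all add: x_def\<close>)
    then show ?thesis
      unfolding E_nabla_def dual_connection_def pullback_connection_def chern_connection_def
        Gpd Hpd mg mh sum_delta_mult Vp dT
      by (simp add: sum_negf)
  qed
  have inner: "E_inner z w g h f p s t = (\<Sum>k\<in>UNIV. \<Sum>i\<in>UNIV. s k i * cnj (t k i))" for s t
    unfolding E_inner_def mg h_fp mult.assoc
    by (simp add: sum_delta_mult flip: sum_distrib_left)
  have "pd z a (pd_bar z b (U_fun \<mu> l z w g h f)) p = wirtinger a (wirtinger_bar b (\<lambda>y.
      \<Sum>k\<in>UNIV. \<Sum>k'\<in>UNIV. \<Sum>i\<in>UNIV. \<Sum>j\<in>UNIV.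
          matrix_inv (G y) $ k' $ k * (Q k i y * cnj (Q k' j y) * T y $ i $ j))) x"
    unfolding x_def by (rule pd_pd_bar_eq_wirtinger[OF zc S Ssub z(2)]) (use xS US in \<open>simp_all add: x_def\<close>)
  also have "\<dots> = (\<Sum>k\<in>UNIV. \<Sum>k'\<in>UNIV. \<Sum>i\<in>UNIV. chern_curvature g z a b k' k p * (Q k i x * cnj (Q k' i x)))
      - (\<Sum>k\<in>UNIV. \<Sum>i\<in>UNIV. \<Sum>j\<in>UNIV.
          (\<Sum>s\<in>UNIV. \<Sum>t\<in>UNIV. map_pd z w f s a p * cnj (map_pd z w f t b p) *
            chern_curvature h w s t i j (f p)) * (Q k i x * cnj (Q k j x)))
      + (\<Sum>k\<in>UNIV. \<Sum>i\<in>UNIV. E_nabla z w g h f a V p k i * cnj (E_nabla z w g h f b V p k i))"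
    unfolding RM RN[symmetric] nabla
    by (rule wirtinger_wirtinger_bar_norm_holomorphic_section[OF S xS Gm(1) Gm(2)[OF xS] Gm(3) Gm(4) Gx
          Td Td2 Th Tx Qh])
  finally show ?thesis
    unfolding inner Vp .
qed

section \<open>Diagonal differential: collapse of the curvature sums\<close>

theorem theorem1p2:
  fixes X :: "'a topology" and A :: "('a, 'm::finite) chart set" and g :: "('a, 'm) metric"
    and Y :: "'b topology" and B :: "('b, 'n::finite) chart set" and h :: "('b, 'n) metric"
    and f :: "'a \<Rightarrow> 'b" and p :: 'a
    and z :: "('a, 'm) chart" and w :: "('b, 'n) chart"
    and \<mu> :: "nat \<Rightarrow> 'm" and \<nu> :: "nat \<Rightarrow> 'n" and lam :: "nat \<Rightarrow> complex"
    and m n l :: nat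
  assumes M: "complex_manifold X A" "hermitian_metric A g"
    and N: "complex_manifold Y B" "hermitian_metric B h"
    and f: "holomorphic_map X A Y B f"
    and dims: "m = CARD('m)" "n = CARD('n)" "m \<le> n"
    and enum: "bij_betw \<mu> {1..m} UNIV" "bij_betw \<nu> {1..n} UNIV"
    and l: "1 \<le> l" "l \<le> m"
    and p: "p \<in> topspace X"
    and z: "z \<in> A" "p \<in> fst z"
    and w: "w \<in> B" "f p \<in> fst w"
    and g_p: "\<And>a b. g z p $ a $ b = (if a = b then 1 else 0)"
    and h_fp: "\<And>i j. h w (f p) $ i $ j = (if i = j then 1 else 0)"
    and df_p: "\<And>\<alpha>. \<alpha> \<in> {1..m} \<Longrightarrow>
      tangent_map z w f p (\<mu> \<alpha>) = (\<Sum>i=1..n. (lam \<alpha> * (if i = \<alpha> then 1 else 0)) *s axis (\<nu> i) 1)"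
    and ordered: "\<And>\<alpha> \<beta>. 1 \<le> \<alpha> \<Longrightarrow> \<alpha> \<le> \<beta> \<Longrightarrow> \<beta> \<le> m \<Longrightarrow> cmod (lam \<beta>) \<le> cmod (lam \<alpha>)"
    and nonzero: "U_fun \<mu> l z w g h f p \<noteq> 0"
  shows "del_delbar z (U_fun \<mu> l z w g h f) p =
    (\<lambda>u v.
      (\<Sum>\<alpha>=1..m. \<Sum>\<beta>=1..m.
        ((\<Sum>\<delta>=1..l. chern_curvature g z (\<mu> \<alpha>) (\<mu> \<beta>) (\<mu> \<delta>) (\<mu> \<delta>) p * (cmod (lam \<delta>))\<^sup>2)
         - (\<Sum>\<gamma>=1..l. chern_curvature h w (\<nu> \<alpha>) (\<nu> \<beta>) (\<nu> \<gamma>) (\<nu> \<gamma>) (f p) *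
              (cmod (lam \<gamma>))\<^sup>2 * lam \<alpha> * cnj (lam \<beta>)))
        * dz_dzbar (\<mu> \<alpha>) (\<mu> \<beta>) u v)
      + nabla_form z w g h f (V_section \<mu> l z w f) p u v)"
proof -
  define V where "V = V_section \<mu> l z w f"
  \<comment> \<open>The components of V at \<open>p\<close> are the values of \<open>lam\<close> cut
    off at \<open>l\<close>, whereas the directions of differentiation see the uncut
    \<open>lam\<close>. Hence the curvature traces end at \<open>l\<close> while \<alpha> and
    \<beta> run up to \<open>m\<close>.\<close>
  define L where "L = (\<lambda>\<delta>. if \<delta> \<le> l then lam \<delta> else 0)"
  have inj\<mu>: "inj_on \<mu> {1..m}" and inj\<nu>: "inj_on \<nu> {1..n}"
    using enum by (auto simp: bij_betw_def)
  have injl: "inj_on \<mu> {1..l}"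
    by (rule inj_on_subset[OF inj\<mu>]) (use l in auto)
  have ind: "(\<Sum>k\<in>UNIV. F k) = (\<Sum>\<delta>=1..m. F (\<mu> \<delta>))" for F :: "'m \<Rightarrow> complex"
    by (rule sum.reindex_bij_betw[OF enum(1), symmetric])
  have df: "map_pd z w f j (\<mu> \<alpha>) p = (if j = \<nu> \<alpha> then lam \<alpha> else 0)" if "\<alpha> \<in> {1..m}" for j \<alpha>
  proof -
    have "map_pd z w f j (\<mu> \<alpha>) p = tangent_map z w f p (\<mu> \<alpha>) $ j"
      by (simp add: tangent_map_def axis_def if_distrib[of "\<lambda>u. _ * u"] cong: if_cong)
    also have "\<dots> = (\<Sum>i=1..n. if i = \<alpha> then lam \<alpha> * axis (\<nu> \<alpha>) 1 $ j else 0)"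
      unfolding df_p[OF that] sum_component by (intro sum.cong refl) simp
    \<comment> \<open>The summand i = \<alpha> does occur, because \<alpha> \<le> m \<le> n.\<close>
    also have "\<dots> = lam \<alpha> * axis (\<nu> \<alpha>) 1 $ j"
      using that dims(3) by simp
    finally show ?thesis
      by (simp add: axis_def)
  qed
  have \<mu>l: "\<mu> \<delta> \<in> \<mu> ` {1..l} \<longleftrightarrow> \<delta> \<le> l" if "\<delta> \<in> {1..m}" for \<delta>
    using inj_on_image_mem_iff[OF inj\<mu> that, of "{1..l}"] l that by auto
  have V: "V (\<mu> \<delta>) i p = (if i = \<nu> \<delta> then L \<delta> else 0)" if "\<delta> \<in> {1..m}" for \<delta> i
    unfolding V_def V_section_def \<mu>l[OF that] df[OF that] L_def by simp
  have to_l: "(\<Sum>\<delta>=1..m. F \<delta> * (L \<delta> * cnj (L \<delta>))) = (\<Sum>\<delta>=1..l. F \<delta> * (cmod (lam \<delta>))\<^sup>2)" for F :: "nat \<Rightarrow> complex"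
  proof -
    have "(\<Sum>\<delta>=1..m. F \<delta> * (L \<delta> * cnj (L \<delta>))) = (\<Sum>\<delta>=1..l. F \<delta> * (L \<delta> * cnj (L \<delta>)))"
      by (rule sum.mono_neutral_right) (use l in \<open>auto simp: L_def\<close>)
    also have "\<dots> = (\<Sum>\<delta>=1..l. F \<delta> * (cmod (lam \<delta>))\<^sup>2)"
      by (intro sum.cong refl) (simp add: L_def complex_norm_square[symmetric] del: of_real_power)
    finally show ?thesis .
  qed
  have coeff: "pd z (\<mu> \<alpha>) (pd_bar z (\<mu> \<beta>) (U_fun \<mu> l z w g h f)) p
    = ((\<Sum>\<delta>=1..l. chern_curvature g z (\<mu> \<alpha>) (\<mu> \<beta>) (\<mu> \<delta>) (\<mu> \<delta>) p * (cmod (lam \<delta>))\<^sup>2)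
         - (\<Sum>\<gamma>=1..l. chern_curvature h w (\<nu> \<alpha>) (\<nu> \<beta>) (\<nu> \<gamma>) (\<nu> \<gamma>) (f p) *
              (cmod (lam \<gamma>))\<^sup>2 * lam \<alpha> * cnj (lam \<beta>)))
      + E_inner z w g h f p (E_nabla z w g h f (\<mu> \<alpha>) V p) (E_nabla z w g h f (\<mu> \<beta>) V p)"
    if \<alpha>\<beta>: "\<alpha> \<in> {1..m}" "\<beta> \<in> {1..m}" for \<alpha> \<beta>
  proof -
    let ?R = "\<lambda>k k'. chern_curvature g z (\<mu> \<alpha>) (\<mu> \<beta>) k' k p"
    let ?S = "\<lambda>i j. chern_curvature h w (\<nu> \<alpha>) (\<nu> \<beta>) i j (f p)"
    have R: "(\<Sum>k\<in>UNIV. \<Sum>k'\<in>UNIV. \<Sum>i\<in>UNIV. ?R k k' * (V k i p * cnj (V k' i p)))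
        = (\<Sum>\<delta>=1..l. ?R (\<mu> \<delta>) (\<mu> \<delta>) * (cmod (lam \<delta>))\<^sup>2)"
    proof -
      \<comment> \<open>By injectivity of \<open>\<nu>\<close>, the components of V for distinct
        \<delta> are supported on distinct frame vectors of the target, so only the diagonal of the
        source curvature survives.\<close>
      have "(\<Sum>i\<in>UNIV. ?R (\<mu> \<delta>) (\<mu> \<delta>') * (V (\<mu> \<delta>) i p * cnj (V (\<mu> \<delta>') i p)))
          = (if \<delta>' = \<delta> then ?R (\<mu> \<delta>) (\<mu> \<delta>) * (L \<delta> * cnj (L \<delta>)) else 0)"
        if "\<delta> \<in> {1..m}" "\<delta>' \<in> {1..m}" for \<delta> \<delta>'
      proof -
        have "\<nu> \<delta> = \<nu> \<delta>' \<longleftrightarrow> \<delta>' = \<delta>"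
          using inj_onD[OF inj\<nu>, of \<delta> \<delta>'] that dims(3) by auto
        moreover have "(\<Sum>i\<in>UNIV. ?R (\<mu> \<delta>) (\<mu> \<delta>') * (V (\<mu> \<delta>) i p * cnj (V (\<mu> \<delta>') i p)))
            = (\<Sum>i\<in>UNIV. if i = \<nu> \<delta> then
                if \<nu> \<delta> = \<nu> \<delta>' then ?R (\<mu> \<delta>) (\<mu> \<delta>') * (L \<delta> * cnj (L \<delta>')) else 0 else 0)"
          unfolding V[OF that(1)] V[OF that(2)] by (intro sum.cong refl) simp
        ultimately show ?thesis by simp
      qed
      then have "(\<Sum>k\<in>UNIV. \<Sum>k'\<in>UNIV. \<Sum>i\<in>UNIV. ?R k k' * (V k i p * cnj (V k' i p)))
          = (\<Sum>\<delta>=1..m. \<Sum>\<delta>'=1..m. if \<delta>' = \<delta> then ?R (\<mu> \<delta>) (\<mu> \<delta>) * (L \<delta> * cnj (L \<delta>)) else 0)"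
        unfolding ind by (intro sum.cong refl) blast
      also have "\<dots> = (\<Sum>\<delta>=1..m. ?R (\<mu> \<delta>) (\<mu> \<delta>) * (L \<delta> * cnj (L \<delta>)))"
        by (intro sum.cong refl) simp
      finally show ?thesis
        unfolding to_l .
    qed
    have S: "(\<Sum>k\<in>UNIV. \<Sum>i\<in>UNIV. \<Sum>j\<in>UNIV.
          (\<Sum>s\<in>UNIV. \<Sum>t\<in>UNIV. map_pd z w f s (\<mu> \<alpha>) p * cnj (map_pd z w f t (\<mu> \<beta>) p) *
            chern_curvature h w s t i j (f p)) * (V k i p * cnj (V k j p)))
        = (\<Sum>\<gamma>=1..l. ?S (\<nu> \<gamma>) (\<nu> \<gamma>) * (cmod (lam \<gamma>))\<^sup>2 * lam \<alpha> * cnj (lam \<beta>))"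
    proof -
      \<comment> \<open>The columns \<open>\<mu> \<alpha>\<close> and \<open>\<mu> \<beta>\<close>
        of the differential have one nonzero entry at most, so the pulled-back slots reduce to
        \<open>\<nu> \<alpha>\<close> and \<open>\<nu> \<beta>\<close> with factor
        \<open>lam \<alpha> * cnj (lam \<beta>)\<close>.\<close>
      have C: "(\<Sum>s\<in>UNIV. \<Sum>t\<in>UNIV. map_pd z w f s (\<mu> \<alpha>) p * cnj (map_pd z w f t (\<mu> \<beta>) p) *
            chern_curvature h w s t i j (f p)) = ?S i j * lam \<alpha> * cnj (lam \<beta>)" for i j
      proof -
        have "(\<Sum>s\<in>UNIV. \<Sum>t\<in>UNIV. map_pd z w f s (\<mu> \<alpha>) p * cnj (map_pd z w f t (\<mu> \<beta>) p) *
              chern_curvature h w s t i j (f p))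
            = (\<Sum>s\<in>UNIV. if s = \<nu> \<alpha> then
                \<Sum>t\<in>UNIV. if t = \<nu> \<beta> then ?S i j * lam \<alpha> * cnj (lam \<beta>) else 0 else 0)"
        proof (intro sum.cong refl)
          fix s
          show "(\<Sum>t\<in>UNIV. map_pd z w f s (\<mu> \<alpha>) p * cnj (map_pd z w f t (\<mu> \<beta>) p) *
              chern_curvature h w s t i j (f p))
            = (if s = \<nu> \<alpha> then
                \<Sum>t\<in>UNIV. if t = \<nu> \<beta> then ?S i j * lam \<alpha> * cnj (lam \<beta>) else 0 else 0)"
            unfolding df[OF \<alpha>\<beta>(1)] df[OF \<alpha>\<beta>(2)]
            by (cases "s = \<nu> \<alpha>") (simp_all add: if_distrib[of cnj] if_distrib[of "\<lambda>u. _ * u"]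
                if_distrib[of "\<lambda>u. u * _"] mult_ac cong: if_cong)
        qed
        then show ?thesis by simp
      qed
      have "(\<Sum>i\<in>UNIV. \<Sum>j\<in>UNIV. ?S i j * lam \<alpha> * cnj (lam \<beta>) * (V (\<mu> \<delta>) i p * cnj (V (\<mu> \<delta>) j p)))
          = ?S (\<nu> \<delta>) (\<nu> \<delta>) * lam \<alpha> * cnj (lam \<beta>) * (L \<delta> * cnj (L \<delta>))" if "\<delta> \<in> {1..m}" for \<delta>
      proof -
        have "(\<Sum>i\<in>UNIV. \<Sum>j\<in>UNIV. ?S i j * lam \<alpha> * cnj (lam \<beta>) * (V (\<mu> \<delta>) i p * cnj (V (\<mu> \<delta>) j p)))
            = (\<Sum>i\<in>UNIV. if i = \<nu> \<delta> then \<Sum>j\<in>UNIV. if j = \<nu> \<delta> then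
                ?S (\<nu> \<delta>) (\<nu> \<delta>) * lam \<alpha> * cnj (lam \<beta>) * (L \<delta> * cnj (L \<delta>)) else 0 else 0)"
        proof (intro sum.cong refl)
          fix i
          show "(\<Sum>j\<in>UNIV. ?S i j * lam \<alpha> * cnj (lam \<beta>) * (V (\<mu> \<delta>) i p * cnj (V (\<mu> \<delta>) j p)))
            = (if i = \<nu> \<delta> then \<Sum>j\<in>UNIV. if j = \<nu> \<delta> then
                ?S (\<nu> \<delta>) (\<nu> \<delta>) * lam \<alpha> * cnj (lam \<beta>) * (L \<delta> * cnj (L \<delta>)) else 0 else 0)"
            unfolding V[OF that]
            by (cases "i = \<nu> \<delta>") (simp_all add: if_distrib[of cnj] if_distrib[of "\<lambda>u. _ * u"]
                if_distrib[of "\<lambda>u. u * _"] mult_ac cong: if_cong)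
        qed
        then show ?thesis by simp
      qed
      then have "(\<Sum>\<delta>=1..m. \<Sum>i\<in>UNIV. \<Sum>j\<in>UNIV.
            ?S i j * lam \<alpha> * cnj (lam \<beta>) * (V (\<mu> \<delta>) i p * cnj (V (\<mu> \<delta>) j p)))
          = (\<Sum>\<delta>=1..m. ?S (\<nu> \<delta>) (\<nu> \<delta>) * lam \<alpha> * cnj (lam \<beta>) * (L \<delta> * cnj (L \<delta>)))"
        by (rule sum.cong[OF refl])
      also have "\<dots> = (\<Sum>\<gamma>=1..l. ?S (\<nu> \<gamma>) (\<nu> \<gamma>) * (cmod (lam \<gamma>))\<^sup>2 * lam \<alpha> * cnj (lam \<beta>))"
        unfolding to_l by (intro sum.cong refl) (simp add: mult_ac)
      finally show ?thesis
        unfolding C ind .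
    qed
    show ?thesis
      unfolding pd_pd_bar_U_fun[OF M N f z w g_p h_fp injl] R S V_def[symmetric] by (rule refl)
  qed
  \<comment> \<open>Both sides expand in the same forms
    \<open>dz_dzbar (\<mu> \<alpha>) (\<mu> \<beta>)\<close>, so equality of the coefficients is
    enough.\<close>
  show ?thesis
    unfolding del_delbar_def nabla_form_def form11_def ind V_def[symmetric]
    by (intro ext) (simp only: coeff distrib_right sum.distrib cong: sum.cong)
qed

end
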